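(* Let $n\ge 1$ and let $r,s\in\mathbb C$ be generic. In the quantum coordinate ring $\mathcal A_{r,s}(2n)$ with generator matrix $A=(a_{ij})_{1\le i,j\le 2n}$ one has $$\mathrm{Pf}_{s^{-1}}\big(A\,\mathbb J_{r}\,A^T\big)=\mathrm{cdet}_{s^{-1}}(A),$$ where $A\mathbb J_{r}A^T=(b'_{ij})_{1\le i,j\le 2n}$ and, for $i<j$, $$b'_{ij}=\sum_{m=1}^n\mathrm{rdet}_r\big(A^{i,j}_{2m-1,2m}\big)=\sum_{m=1}^n\big(a_{i,2m-1}\,a_{j,2m}-r\,a_{i,2m}\,a_{j,2m-1}\big).$$
   Context: Generic means: $r,s$ are nonzero and none of $r$, $s$, $r/s$ is a root of unity. For $N\ge1$, $\mathcal A_{r,s}(N)$ is the unital associative $\mathbb C$-algebra generated by $a_{ij}$, $1\le i,j\le N$, subject to the relations, for all $i<j$ and $k<l$ (the first for every row $i$, the second for every column $k$): $a_{ik}a_{il}=r\,a_{il}a_{ik}$; $a_{ik}a_{jk}=s^{-1}a_{jk}a_{ik}$; $r\,a_{il}a_{jk}=s^{-1}a_{jk}a_{il}$; $a_{ik}a_{jl}-a_{jl}a_{ik}=(r-s)a_{il}a_{jk}$. The quantum column-determinant is $\mathrm{cdet}_{s^{-1}}(A)=\sum_{\sigma\in S_N}(-s)^{-l(\sigma)}a_{\sigma(1),1}\cdots a_{\sigma(N),N}$, where $l(\sigma)$ is the number of inversions of $\sigma$. The row-minor with rows $i_1,\dots,i_t$ and columns $j_1,\dots,j_t$ is $\mathrm{rdet}_r(A^{i_1\ldots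 i_t}_{j_1\ldots j_t})=\sum_{\sigma\in S_t}(-r)^{l(\sigma)}a_{i_1,j_{\sigma(1)}}\cdots a_{i_t,j_{\sigma(t)}}$. $\mathbb J_v$ is the $2n\times 2n$ block-diagonal matrix $\mathrm{diag}(J_v,\dots,J_v)$ with $n$ blocks $J_v=\begin{pmatrix}0&1\\-v&0\end{pmatrix}$. For a $2n\times 2n$ matrix $B=(b_{ij})$ with entries in an associative $\mathbb C$-algebra, the quantum Pfaffian is $$\mathrm{Pf}_v(B)=\frac1{[n]_{v^4}!}\sum_{\sigma\in\Pi'}(-v)^{l(\sigma)}b_{\sigma(1)\sigma(2)}b_{\sigma(3)\sigma(4)}\cdots b_{\sigma(2n-1)\sigma(2n)},$$ where $\Pi'$ is the set of $\sigma\in S_{2n}$ with $\sigma(2i-1)<\sigma(2i)$ for $i=1,\dots,n$, and $[n]_u!=[n]_u\cdots[1]_u$, $[k]_u=1+u+\cdots+u^{k-1}$. *)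

theory Defs
  imports
    "HOL-Algebra.QuotRing"
    "HOL-Algebra.Module"
    "HOL-Library.Poly_Mapping"
    "HOL-Combinatorics.Permutations"
    Complex_Main
begin

section \<open>Free associative algebras\<close>

text \<open>Words form the free monoid. It is written additively because the convolution product of
  \<^theory>\<open>HOL-Library.Poly_Mapping\<close> is indexed by an additive monoid.\<close>

datatype 'x free_word = Word (letters: "'x list")

instantiation free_word :: (type) monoid_add
begin
definition zero_free_word :: "'a free_word" where "0 = Word []"
definition plus_free_word :: "'a free_word \<Rightarrow> 'a free_word \<Rightarrow> 'a free_word"
  where "v + w = Word (letters v @ letters w)"
instance by standard (simp_all add: zero_free_word_def plus_free_word_def)
end

type_synonym 'x free_alg = "'x free_word \<Rightarrow>\<^sub>0 complex"

definition scal :: "complex \<Rightarrow> 'x free_alg"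
  where "scal c = Poly_Mapping.single 0 c"

definition var :: "'x \<Rightarrow> 'x free_alg"
  where "var x = Poly_Mapping.single (Word [x]) 1"

text \<open>The record type \<open>module\<close> is used only as a signature (ring operations and scalar
  multiplication); the locales \<open>module\<close> and \<open>algebra\<close> of HOL-Algebra, which concern commutative
  algebras, play no role.\<close>

definition free_algebra :: "'x set \<Rightarrow> (complex, 'x free_alg) module"
  where "free_algebra X =
    \<lparr>carrier = {p. \<forall>w \<in> Poly_Mapping.keys p. set (letters w) \<subseteq> X},
     monoid.mult = (*), one = 1, zero = 0, add = (+), smult = (\<lambda>c p. scal c * p)\<rparr>"

text \<open>The algebra with generators \<open>X\<close> and relations \<open>p = 0\<close> for \<open>p \<in> S\<close>. Ideals of HOL-Algebra
  are two-sided; the scalar \<open>c\<close> acts as multiplication by the class of the constant \<open>c\<close>.\<close>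

definition presented_algebra ::
    "'x set \<Rightarrow> 'x free_alg set \<Rightarrow> (complex, 'x free_alg set) module"
  where "presented_algebra X S =
    (let F = free_algebra X; I = genideal F S; Q = F Quot I
     in ring.extend Q (module.fields (\<lambda>c x. (I +>\<^bsub>F\<^esub> scal c) \<otimes>\<^bsub>Q\<^esub> x)))"

definition presented_gen :: "'x set \<Rightarrow> 'x free_alg set \<Rightarrow> 'x \<Rightarrow> 'x free_alg set"
  where "presented_gen X S x = genideal (free_algebra X) S +>\<^bsub>free_algebra X\<^esub> var x"


section \<open>The two-parameter quantum coordinate ring\<close>

definition root_of_unity :: "complex \<Rightarrow> bool"
  where "root_of_unity z \<longleftrightarrow> (\<exists>k::nat. k \<ge> 1 \<and> z ^ k = 1)"

definition generic :: "complex \<Rightarrow> complex \<Rightarrow> bool"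
  where "generic r s \<longleftrightarrow> r \<noteq> 0 \<and> s \<noteq> 0 \<and>
    \<not> root_of_unity r \<and> \<not> root_of_unity s \<and> \<not> root_of_unity (r / s)"

definition index_pairs :: "nat \<Rightarrow> (nat \<times> nat) set"
  where "index_pairs N = {1..N} \<times> {1..N}"

definition qcoord_relations :: "complex \<Rightarrow> complex \<Rightarrow> nat \<Rightarrow> (nat \<times> nat) free_alg set"
  where "qcoord_relations r s N = (let a = (\<lambda>i j. var (i, j)) in
      {a i k * a i l - scal r * (a i l * a i k) | i k l.
         i \<in> {1..N} \<and> k \<in> {1..N} \<and> l \<in> {1..N} \<and> k < l}
    \<union> {a i k * a j k - scal (inverse s) * (a j k * a i k) | i j k.
         i \<in> {1..N} \<and> j \<in> {1..N} \<and> k \<in> {1..N} \<and> i < j}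
    \<union> {scal r * (a i l * a j k) - scal (inverse s) * (a j k * a i l) | i j k l.
         i \<in> {1..N} \<and> j \<in> {1..N} \<and> k \<in> {1..N} \<and> l \<in> {1..N} \<and> i < j \<and> k < l}
    \<union> {(a i k * a j l - a j l * a i k) - scal (r - s) * (a i l * a j k) | i j k l.
         i \<in> {1..N} \<and> j \<in> {1..N} \<and> k \<in> {1..N} \<and> l \<in> {1..N} \<and> i < j \<and> k < l})"

definition qcoord_ring ::
    "complex \<Rightarrow> complex \<Rightarrow> nat \<Rightarrow> (complex, (nat \<times> nat) free_alg set) module"
  where "qcoord_ring r s N = presented_algebra (index_pairs N) (qcoord_relations r s N)"

definition qcoord_gen ::
    "complex \<Rightarrow> complex \<Rightarrow> nat \<Rightarrow> nat \<Rightarrow> nat \<Rightarrow> (nat \<times> nat) free_alg set"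
  where "qcoord_gen r s N i j =
    presented_gen (index_pairs N) (qcoord_relations r s N) (i, j)"


section \<open>Matrices, quantum determinants and quantum Pfaffians\<close>

text \<open>A matrix over a complex algebra \<open>R\<close> is a function of a row and a column index, both
  starting at 1. Its size is passed separately where it matters; entries outside are irrelevant.\<close>

definition oprod :: "('a, 'm) ring_scheme \<Rightarrow> 'a list \<Rightarrow> 'a"
  where "oprod R xs = foldr (\<otimes>\<^bsub>R\<^esub>) xs \<one>\<^bsub>R\<^esub>"

definition mat_mult ::
    "('a, 'm) ring_scheme \<Rightarrow> nat \<Rightarrow> (nat \<Rightarrow> nat \<Rightarrow> 'a) \<Rightarrow> (nat \<Rightarrow> nat \<Rightarrow> 'a) \<Rightarrow> nat \<Rightarrow> nat \<Rightarrow> 'a"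
  where "mat_mult R N A B i j = (\<Oplus>\<^bsub>R\<^esub>k\<in>{1..N}. A i k \<otimes>\<^bsub>R\<^esub> B k j)"

definition mat_transpose :: "(nat \<Rightarrow> nat \<Rightarrow> 'a) \<Rightarrow> nat \<Rightarrow> nat \<Rightarrow> 'a"
  where "mat_transpose A i j = A j i"

definition mat_scalars ::
    "(complex, 'a, 'm) module_scheme \<Rightarrow> (nat \<Rightarrow> nat \<Rightarrow> complex) \<Rightarrow> nat \<Rightarrow> nat \<Rightarrow> 'a"
  where "mat_scalars R C i j = C i j \<odot>\<^bsub>R\<^esub> \<one>\<^bsub>R\<^esub>"

text \<open>The \<open>m\<close>-th diagonal block occupies rows and columns \<open>2m - 1\<close> and \<open>2m\<close>.\<close>

definition JJ :: "complex \<Rightarrow> nat \<Rightarrow> nat \<Rightarrow> complex"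
  where "JJ v i j =
    (if odd i \<and> j = i + 1 then 1 else if even i \<and> i = j + 1 then - v else 0)"

definition inversions :: "nat set \<Rightarrow> (nat \<Rightarrow> nat) \<Rightarrow> nat"
  where "inversions S \<sigma> = card {(i, j). i \<in> S \<and> j \<in> S \<and> i < j \<and> \<sigma> j < \<sigma> i}"

text \<open>In \<open>cdet R v N A\<close> the weight is \<open>(-v)^l\<close>; for \<open>v = inverse s\<close> this is \<open>(-s)^(-l)\<close>.\<close>

definition cdet ::
    "(complex, 'a, 'm) module_scheme \<Rightarrow> complex \<Rightarrow> nat \<Rightarrow> (nat \<Rightarrow> nat \<Rightarrow> 'a) \<Rightarrow> 'a"
  where "cdet R v N A =
    (\<Oplus>\<^bsub>R\<^esub>\<sigma>\<in>{\<sigma>. \<sigma> permutes {1..N}}.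
       (- v) ^ inversions {1..N} \<sigma> \<odot>\<^bsub>R\<^esub> oprod R (map (\<lambda>k. A (\<sigma> k) k) [1..<N + 1]))"

text \<open>The minor of \<open>A\<close> with the given row and column lists (of equal length). List positions, and
  hence the permutations, start at 0, which does not affect inversion numbers.\<close>

definition rdet_minor ::
    "(complex, 'a, 'm) module_scheme \<Rightarrow> complex \<Rightarrow> (nat \<Rightarrow> nat \<Rightarrow> 'a) \<Rightarrow> nat list \<Rightarrow> nat list \<Rightarrow> 'a"
  where "rdet_minor R v A rows cols =
    (\<Oplus>\<^bsub>R\<^esub>\<sigma>\<in>{\<sigma>. \<sigma> permutes {..<length rows}}.
       (- v) ^ inversions {..<length rows} \<sigma> \<odot>\<^bsub>R\<^esub>
         oprod R (map (\<lambda>k. A (rows ! k) (cols ! \<sigma> k)) [0..<length rows]))"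

definition qint :: "complex \<Rightarrow> nat \<Rightarrow> complex"
  where "qint u k = (\<Sum>i<k. u ^ i)"

definition qfact :: "complex \<Rightarrow> nat \<Rightarrow> complex"
  where "qfact u n = (\<Prod>k = 1..n. qint u k)"

definition Pf_perms :: "nat \<Rightarrow> (nat \<Rightarrow> nat) set"
  where "Pf_perms n =
    {\<sigma>. \<sigma> permutes {1..2 * n} \<and> (\<forall>i\<in>{1..n}. \<sigma> (2 * i - 1) < \<sigma> (2 * i))}"

definition Pf ::
    "(complex, 'a, 'm) module_scheme \<Rightarrow> complex \<Rightarrow> nat \<Rightarrow> (nat \<Rightarrow> nat \<Rightarrow> 'a) \<Rightarrow> 'a"
  where "Pf R v n B =
    (1 / qfact (v ^ 4) n) \<odot>\<^bsub>R\<^esub>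
    (\<Oplus>\<^bsub>R\<^esub>\<sigma>\<in>Pf_perms n.
       (- v) ^ inversions {1..2 * n} \<sigma> \<odot>\<^bsub>R\<^esub>
         oprod R (map (\<lambda>i. B (\<sigma> (2 * i - 1)) (\<sigma> (2 * i))) [1..<n + 1]))"

end

theory Submission
  imports
    Defs
    "HOL-Algebra.UnivPoly"
    "HOL-Combinatorics.Multiset_Permutations"
begin

text \<open>Let \<open>v = 1/s\<close> and let \<open>x\<^sub>1, \<dots>, x\<^sub>N\<close>, with \<open>N = 2n\<close>, generate the quantum exterior algebra
  \<open>x\<^sub>j x\<^sub>i = -v x\<^sub>i x\<^sub>j\<close> (\<open>i < j\<close>), \<open>x\<^sub>i x\<^sub>i = 0\<close>, commuting with the \<open>a\<^sub>i\<^sub>j\<close>. The relations of the coordinate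
  ring say that the \<open>\<delta>\<^sub>k = \<Sum>\<^sub>i a\<^sub>i\<^sub>k x\<^sub>i\<close> satisfy the relations of the \<open>x\<^sub>k\<close>, so
  \<open>\<delta>\<^sub>1 \<cdots> \<delta>\<^sub>N = cdet(A) x\<^sub>1 \<cdots> x\<^sub>N\<close>. The element \<open>\<Omega> = \<Sum>\<^sub>m \<delta>\<^sub>2\<^sub>m\<^sub>-\<^sub>1 \<delta>\<^sub>2\<^sub>m\<close> equals
  \<open>\<Sum>\<^sub>i\<^sub><\<^sub>j b'\<^sub>i\<^sub>j x\<^sub>i x\<^sub>j\<close>. Expanding the \<open>n\<close>-th power of \<open>\<Omega>\<close> in the \<open>b'\<close> gives \<open>[n]! Pf\<close>, with base
  \<open>v\<^sup>4\<close>; expanding it in the \<open>\<delta>\<close> gives \<open>[n]! cdet(A)\<close>, because the summands \<open>v\<^sup>4\<close>-commute and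
  square to zero. Only products of top degree matter, so the exterior algebra itself is replaced
  by the coefficient \<open>eps v w\<close> of \<open>x\<^sub>1 \<cdots> x\<^sub>N\<close> in the word \<open>w\<close>.\<close>

section \<open>Inversions of words\<close>

definition words :: "'a set \<Rightarrow> nat \<Rightarrow> 'a list set"
  where "words S n = {w. set w \<subseteq> S \<and> length w = n}"

lemma finite_words: "finite S \<Longrightarrow> finite (words S n)"
  unfolding words_def by (rule finite_lists_length_eq)

lemma words_0 [simp]: "words S 0 = {[]}"
  by (auto simp: words_def)

lemma sum_words_Suc:
  assumes "finite S"
  shows "(\<Sum>w\<in>words S (Suc n). f w) = (\<Sum>x\<in>S. \<Sum>w\<in>words S n. f (x # w))"
proof -
  have *: "words S (Suc n) = (\<lambda>(x, w). x # w) ` (S \<times> words S n)"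
    by (force simp: words_def length_Suc_conv image_iff)
  have "inj_on (\<lambda>(x, w). x # w) (S \<times> words S n)"
    by (auto simp: inj_on_def)
  then have "(\<Sum>w\<in>words S (Suc n). f w) = (\<Sum>(x, w)\<in>S \<times> words S n. f (x # w))"
    unfolding * by (subst sum.reindex) (auto simp: case_prod_unfold)
  then show ?thesis
    by (simp add: sum.cartesian_product)
qed

lemma sum_words_add:
  assumes "finite S"
  shows "(\<Sum>w\<in>words S (m + n). f w) = (\<Sum>u\<in>words S m. \<Sum>t\<in>words S n. f (u @ t))"
proof (induction m arbitrary: f)
  case (Suc m)
  show ?case
    by (simp add: sum_words_Suc[OF assms] Suc)
qed simp

fun linv :: "nat list \<Rightarrow> nat"
  where "linv [] = 0"
  | "linv (x # xs) = length (filter (\<lambda>y. y < x) xs) + linv xs"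

text \<open>For distinct letters this is the coefficient of the increasing monomial on the letters
  of \<open>w\<close>. It makes sense for words of every length, which the inductions with a growing
  prefix rely on.\<close>

definition eps :: "complex \<Rightarrow> nat list \<Rightarrow> complex"
  where "eps v w = (if distinct w then (- v) ^ linv w else 0)"

lemma linv_swap: "i < j \<Longrightarrow> linv (u @ j # i # t) = Suc (linv (u @ i # j # t))"
  by (induction u) auto

text \<open>The exterior relation \<open>x\<^sub>j x\<^sub>i = -v x\<^sub>i x\<^sub>j\<close> inside
  an arbitrary word: exchanging two neighbours alters the status of that one pair of positions only.
  \<open>eps_dup\<close> is the companion relation for squares.\<close>

lemma eps_swap: "i < j \<Longrightarrow> eps v (u @ j # i # t) = - v * eps v (u @ i # j # t)"
  using linv_swap[of i j u t] by (auto simp: eps_def)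

lemma eps_dup [simp]: "eps v (u @ i # i # t) = 0"
  by (simp add: eps_def)

lemma linv_sorted: "sorted w \<Longrightarrow> linv w = 0"
  by (induction w) (auto simp: filter_empty_conv)

text \<open>The first letter \<open>x\<close> of a word contributes one inversion for each element
  of \<open>S\<close> below it, whatever the order of the remaining letters. So the sum factors, and
  the first letter accounts for one q-integer.\<close>

lemma sum_power_linv_permutations_of_set:
  "finite S \<Longrightarrow> (\<Sum>w\<in>permutations_of_set S. u ^ linv w) = qfact u (card S)"
proof (induction "card S" arbitrary: S)
  case 0
  then show ?case by (simp add: qfact_def)
next
  case (Suc k)
  then have ne: "S \<noteq> {}" by auto
  have fin: "finite S" by fact
  \<comment> \<open>The exponents are the ranks of the elements, hence 0, ...,
    \<open>card S - 1\<close>. Adding a new maximum leaves all earlier ranks unchanged.\<close>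
  have below: "(\<Sum>x\<in>S. u ^ card {y \<in> S. y < x}) = qint u (card S)" if "finite S" for S :: "nat set"
    using that
  proof (induction S rule: finite_linorder_max_induct)
    case (insert b A)
    have "(\<Sum>x\<in>insert b A. u ^ card {y \<in> insert b A. y < x})
        = u ^ card {y \<in> insert b A. y < b} + (\<Sum>x\<in>A. u ^ card {y \<in> insert b A. y < x})"
      using insert by (subst sum.insert) auto
    also have "{y \<in> insert b A. y < b} = A"
      using insert by auto
    also have "(\<Sum>x\<in>A. u ^ card {y \<in> insert b A. y < x}) = (\<Sum>x\<in>A. u ^ card {y \<in> A. y < x})"
      using insert by (intro sum.cong refl arg_cong[where f = "\<lambda>T. u ^ card T"]) force
    finally show ?case
      using insert by (subst card_insert_disjoint) (auto simp: qint_def)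
  qed (simp add: qint_def)
  have "(\<Sum>w\<in>permutations_of_set S. u ^ linv w)
      = (\<Sum>x\<in>S. \<Sum>w\<in>permutations_of_set (S - {x}). u ^ linv (x # w))"
    unfolding permutations_of_set_nonempty[OF ne]
    by (subst sum.UNION_disjoint) (auto simp: fin sum.reindex)
  also have "\<dots> = (\<Sum>x\<in>S. u ^ card {y \<in> S. y < x} * qfact u k)"
  proof (intro sum.cong refl)
    fix x assume x: "x \<in> S"
    have "linv (x # w) = card {y \<in> S. y < x} + linv w"
      if "w \<in> permutations_of_set (S - {x})" for w
    proof -
      have "length (filter (\<lambda>y. y < x) w) = card (set (filter (\<lambda>y. y < x) w))"
        using that by (intro distinct_card[symmetric]) (auto dest: permutations_of_setD)
      also have "set (filter (\<lambda>y. y < x) w) = {y \<in> S. y < x}"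
        using permutations_of_setD(1)[OF that] by auto
      finally show ?thesis by simp
    qed
    then have "(\<Sum>w\<in>permutations_of_set (S - {x}). u ^ linv (x # w))
       = u ^ card {y \<in> S. y < x} * (\<Sum>w\<in>permutations_of_set (S - {x}). u ^ linv w)"
      by (simp add: sum_distrib_left power_add)
    also have "(\<Sum>w\<in>permutations_of_set (S - {x}). u ^ linv w) = qfact u k"
      using Suc.hyps(1)[of "S - {x}"] fin x by (simp add: card_Diff_singleton flip: Suc.hyps(2))
    finally show "(\<Sum>w\<in>permutations_of_set (S - {x}). u ^ linv (x # w))
       = u ^ card {y \<in> S. y < x} * qfact u k" .
  qed
  also have "\<dots> = qint u (card S) * qfact u k"
    by (simp add: below fin flip: sum_distrib_right)
  also have "\<dots> = qfact u (card S)"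
    by (simp add: qfact_def flip: Suc.hyps(2))
  finally show ?case .
qed

section \<open>Words split into consecutive pairs, and blocks of two columns\<close>

fun pairs :: "'a list \<Rightarrow> ('a \<times> 'a) list"
  where "pairs (x # y # w) = (x, y) # pairs w"
  | "pairs w = []"

text \<open>The column word that arises in a power of \<Omega> when the summand
  \<open>\<delta>\<^sub>2\<^sub>m\<^sub>-\<^sub>1 \<delta>\<^sub>2\<^sub>m\<close> is taken from
  successive factors, with \<open>m\<close> running through \<open>ms\<close>.\<close>

definition doubled :: "nat list \<Rightarrow> nat list"
  where "doubled ms = concat (map (\<lambda>m. [2 * m - 1, 2 * m]) ms)"

lemma doubled_simps [simp]:
  "doubled [] = []" "doubled (m # ms) = (2 * m - 1) # (2 * m) # doubled ms"
  by (simp_all add: doubled_def)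

lemma length_doubled [simp]: "length (doubled ms) = 2 * length ms"
  by (induction ms) auto

lemma set_doubled: "set (doubled ms) = (\<Union>m\<in>set ms. {2 * m - 1, 2 * m})"
  by (induction ms) auto

text \<open>The source of the base \<open>v\<^sup>4\<close>: two blocks in the wrong order give four
  inverted pairs of letters, and a single block gives none. The block of 0 must be excluded because
  truncated subtraction would turn it into \<open>[0, 0]\<close>.\<close>

lemma eps_doubled:
  assumes "0 \<notin> set ms"
  shows "eps v (doubled ms) = (if distinct ms then (v ^ 4) ^ linv ms else 0)"
proof -
  have dist: "distinct (doubled ms) = distinct ms"
    using assms
  proof (induction ms)
    case (Cons m ms)
    have "{2 * m - 1, 2 * m} \<inter> {2 * k - 1, 2 * k} = {}" if "k \<in> set ms" "m \<noteq> k" for k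
    proof -
      have "k \<noteq> 0" "m \<noteq> 0" using Cons.prems that by (auto intro: gr0I)
      with that show ?thesis by auto
    qed
    moreover have "2 * m - 1 \<noteq> 2 * m" using Cons.prems by auto
    ultimately have "m \<notin> set ms \<Longrightarrow> 2 * m - 1 \<notin> set (doubled ms) \<and> 2 * m \<notin> set (doubled ms)"
      unfolding set_doubled by blast
    moreover have "2 * m - 1 \<in> set (doubled ms)" if "m \<in> set ms"
      using that by (auto simp: set_doubled)
    ultimately show ?case
      using Cons \<open>2 * m - 1 \<noteq> 2 * m\<close> by auto
  qed simp
  \<comment> \<open>The two letters of another block lie on the same side of both
    \<open>2 * m - 1\<close> and \<open>2 * m\<close>. Each of these two letters therefore sees
    twice the number of smaller blocks.\<close>
  have filt: "length (filter (\<lambda>y. y < 2 * m - 1) (doubled ms)) = 2 * length (filter (\<lambda>y. y < m) ms)"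
     "length (filter (\<lambda>y. y < 2 * m) (doubled ms)) = 2 * length (filter (\<lambda>y. y < m) ms)"
    if "m \<notin> set ms" "m \<noteq> 0" "0 \<notin> set ms" for m and ms
    using that by (induction ms) auto
  have "distinct ms \<Longrightarrow> linv (doubled ms) = 4 * linv ms"
    using assms by (induction ms) (auto simp: filt[unfolded One_nat_def])
  then show ?thesis
    by (simp add: eps_def dist power_mult)
qed

lemma pairs_snoc: "even (length w) \<Longrightarrow> pairs (w @ [x, y]) = pairs w @ [(x, y)]"
  by (induction w rule: pairs.induct) auto

lemma set_pairs: "(i, j) \<in> set (pairs w) \<Longrightarrow> i \<in> set w \<and> j \<in> set w"
  by (induction w rule: pairs.induct) auto

lemma pairs_map_upt:
  "pairs (map g [1..<2 * n + 1]) = map (\<lambda>i. (g (2 * i - 1), g (2 * i))) [1..<n + 1]"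
proof (induction n)
  case (Suc n)
  have "[1..<2 * Suc n + 1] = [1..<2 * n + 1] @ [2 * n + 1, 2 * n + 2]"
    by simp
  then show ?case
    using Suc by (simp only: map_append list.map) (subst pairs_snoc, auto)
qed simp

section \<open>Permutations in one-line notation\<close>

lemma inversions_eq_linv: "inversions {1..N} \<sigma> = linv (map \<sigma> [1..<N + 1])"
proof -
  \<comment> \<open>The interval may start anywhere, so that the induction can remove its first
    position just as \<open>linv\<close> removes the head of a list.\<close>
  have gen: "inversions {k..<k + m} \<sigma> = linv (map \<sigma> [k..<k + m])" for k m
  proof (induction m arbitrary: k)
    case (Suc m)
    let ?T = "{Suc k..<Suc k + m}"
    let ?L = "{j \<in> ?T. \<sigma> j < \<sigma> k}"
    let ?R = "{(i, j). i \<in> ?T \<and> j \<in> ?T \<and> i < j \<and> \<sigma> j < \<sigma> i}"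
    have *: "x \<in> {k..<k + Suc m} \<longleftrightarrow> x = k \<or> x \<in> ?T" for x
      by auto
    have "{(i, j). i \<in> {k..<k + Suc m} \<and> j \<in> {k..<k + Suc m} \<and> i < j \<and> \<sigma> j < \<sigma> i}
        = Pair k ` ?L \<union> ?R"
      unfolding * by (auto simp: image_iff)
    moreover have "finite ?R"
      by (rule finite_subset[of _ "?T \<times> ?T"]) auto
    moreover have "Pair k ` ?L \<inter> ?R = {}"
      by auto
    ultimately have "inversions {k..<k + Suc m} \<sigma> = card (Pair k ` ?L) + inversions ?T \<sigma>"
      by (simp add: inversions_def card_Un_disjoint)
    moreover have "card (Pair k ` ?L) = card ?L"
      by (rule card_image) (simp add: inj_on_def)
    moreover have "?L = set (filter (\<lambda>j. \<sigma> j < \<sigma> k) [Suc k..<Suc k + m])"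
      by (auto simp del: upt_Suc)
    moreover have "card \<dots> = length (filter (\<lambda>j. \<sigma> j < \<sigma> k) [Suc k..<Suc k + m])"
      by (rule distinct_card) simp
    ultimately have "inversions {k..<k + Suc m} \<sigma>
        = length (filter (\<lambda>j. \<sigma> j < \<sigma> k) [Suc k..<Suc k + m]) + linv (map \<sigma> [Suc k..<Suc k + m])"
      by (simp only: Suc)
    also have "\<dots> = linv (map \<sigma> (k # [Suc k..<Suc k + m]))"
      by (simp add: filter_map o_def del: upt_Suc)
    also have "k # [Suc k..<Suc k + m] = [k..<k + Suc m]"
      by (simp add: upt_conv_Cons del: upt_Suc)
    finally show ?case .
  qed (simp add: inversions_def)
  show ?thesis
    using gen[of 1 N] by (simp add: atLeastLessThanSuc_atLeastAtMost del: upt_Suc)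
qed

lemma bij_betw_permutes_permutations_of_set:
  "bij_betw (\<lambda>\<sigma>. map \<sigma> [1..<N + 1]) {\<sigma>. \<sigma> permutes {1..N}} (permutations_of_set {1..N})"
proof -
  have inj: "inj_on (\<lambda>\<sigma>. map \<sigma> [1..<N + 1]) {\<sigma>. \<sigma> permutes {1..N}}"
  proof (rule inj_onI, rule ext)
    fix \<sigma> \<tau> x
    assume "\<sigma> \<in> {\<sigma>. \<sigma> permutes {1..N}}" "\<tau> \<in> {\<sigma>. \<sigma> permutes {1..N}}"
      "map \<sigma> [1..<N + 1] = map \<tau> [1..<N + 1]"
    then show "\<sigma> x = \<tau> x"
      by (cases "x \<in> {1..N}") (auto simp: permutes_not_in simp del: upt_Suc)
  qed
  have sub: "(\<lambda>\<sigma>. map \<sigma> [1..<N + 1]) ` {\<sigma>. \<sigma> permutes {1..N}} \<subseteq> permutations_of_set {1..N}"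
  proof clarify
    fix \<sigma> assume \<sigma>: "\<sigma> permutes {1..N}"
    have "set (map \<sigma> [1..<N + 1]) = {1..N}"
      using permutes_image[OF \<sigma>] by (simp add: atLeastLessThanSuc_atLeastAtMost del: upt_Suc)
    moreover have "distinct (map \<sigma> [1..<N + 1])"
      using permutes_inj_on[OF \<sigma>] by (simp add: distinct_map)
    ultimately show "map \<sigma> [1..<N + 1] \<in> permutations_of_set {1..N}"
      by (rule permutations_of_setI)
  qed
  \<comment> \<open>Surjectivity by counting: the injective image has as many elements as its
    target.\<close>
  have "card ((\<lambda>\<sigma>. map \<sigma> [1..<N + 1]) ` {\<sigma>. \<sigma> permutes {1..N}}) = card (permutations_of_set {1..N})"
    by (subst card_image[OF inj]) (simp add: card_permutations)
  with sub have "(\<lambda>\<sigma>. map \<sigma> [1..<N + 1]) ` {\<sigma>. \<sigma> permutes {1..N}} = permutations_of_set {1..N}"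
    by (intro card_subset_eq) auto
  with inj show ?thesis
    by (simp add: bij_betw_def)
qed

lemma permutations_of_set_eq_words:
  "permutations_of_set {1..N} = {w \<in> words {1..N} N. distinct w}"
proof (intro equalityI subsetI)
  fix w assume "w \<in> {w \<in> words {1..N} N. distinct w}"
  then have w: "set w \<subseteq> {1..N}" "length w = N" "distinct w" by (auto simp: words_def)
  then have "set w = {1..N}"
    by (intro card_subset_eq) (auto simp: distinct_card)
  with w show "w \<in> permutations_of_set {1..N}" by (auto intro: permutations_of_setI)
next
  fix w assume "w \<in> permutations_of_set {1..N}"
  then have "set w = {1..N}" "distinct w" by (auto dest: permutations_of_setD)
  with distinct_card[of w] show "w \<in> {w \<in> words {1..N} N. distinct w}"
    by (simp add: words_def)
qed

text \<open>Supplies the place where the sorting in \<open>qdet_eps\<close> acts. The weak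
  inequality also catches two equal neighbours, where the product of columns vanishes.\<close>

lemma exists_adjacent_descent:
  fixes K :: "'a::linorder list"
  assumes "\<not> sorted_wrt (<) K"
  obtains u x y t where "K = u @ x # y # t" "y \<le> x"
  using assms
proof (induction K arbitrary: thesis)
  case (Cons x K)
  show ?case
  proof (cases "sorted_wrt (<) K")
    case True
    with Cons.prems(2) obtain y t where K: "K = y # t"
      by (cases K) auto
    have "\<not> x < y"
      using True Cons.prems(2) unfolding K by auto
    then show ?thesis
      using Cons.prems(1)[of "[]" x y t] K by simp
  next
    case False
    then obtain u y z t where "K = u @ y # z # t" "z \<le> y"
      using Cons.IH by blast
    then show ?thesis
      using Cons.prems(1)[of "x # u" y z t] by simp
  qed
qed simp

text \<open>For the one-line word of a permutation of \<open>{1..2 * n}\<close> this is the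
  condition that defines \<open>Pf_perms\<close>.\<close>

definition ascending_pairs :: "nat list \<Rightarrow> bool"
  where "ascending_pairs w \<longleftrightarrow> (\<forall>(i, j)\<in>set (pairs w). i < j)"

lemma ascending_pairs_simps [simp]:
  "ascending_pairs []" "ascending_pairs (i # j # w) \<longleftrightarrow> i < j \<and> ascending_pairs w"
  by (simp_all add: ascending_pairs_def)

definition pair_prod :: "('b \<Rightarrow> 'b \<Rightarrow> 'a::monoid_mult) \<Rightarrow> 'b list \<Rightarrow> 'a"
  where "pair_prod f w = prod_list (map (\<lambda>(i, j). f i j) (pairs w))"

lemma pair_prod_simps [simp]:
  "pair_prod f [] = 1" "pair_prod f (i # j # w) = f i j * pair_prod f w"
  by (simp_all add: pair_prod_def)

section \<open>Quantum determinants modulo an ideal\<close>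

text \<open>Working with congruences modulo \<open>I\<close> in a type-class ring avoids computing in the quotient
  structure. The ideal is two-sided only relative to the subring \<open>C\<close>.\<close>

locale quantum_matrix =
  fixes C I :: "'a::ring_1 set" and sc :: "complex \<Rightarrow> 'a"
    and a :: "nat \<Rightarrow> nat \<Rightarrow> 'a" and N :: nat and r v :: complex
  assumes C_add: "x \<in> C \<Longrightarrow> y \<in> C \<Longrightarrow> x + y \<in> C"
    and C_mult: "x \<in> C \<Longrightarrow> y \<in> C \<Longrightarrow> x * y \<in> C"
    and C_sc: "sc z \<in> C"
    and C_gen: "i \<in> {1..N} \<Longrightarrow> j \<in> {1..N} \<Longrightarrow> a i j \<in> C"
    and I_zero: "0 \<in> I"
    and I_add: "x \<in> I \<Longrightarrow> y \<in> I \<Longrightarrow> x + y \<in> I"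
    and I_mult_left: "x \<in> I \<Longrightarrow> y \<in> C \<Longrightarrow> y * x \<in> I"
    and I_mult_right: "x \<in> I \<Longrightarrow> y \<in> C \<Longrightarrow> x * y \<in> I"
    and sc_add: "sc (z + z') = sc z + sc z'"
    and sc_mult: "sc (z * z') = sc z * sc z'"
    and sc_1: "sc 1 = 1"
    and sc_commute: "sc z * x = x * sc z"
    and v_nonzero: "v \<noteq> 0"
    and column_relation: "i \<in> {1..N} \<Longrightarrow> j \<in> {1..N} \<Longrightarrow> k \<in> {1..N} \<Longrightarrow> i < j \<Longrightarrow>
      a i k * a j k - sc v * (a j k * a i k) \<in> I"
    and antidiagonal_relation: "i \<in> {1..N} \<Longrightarrow> j \<in> {1..N} \<Longrightarrow> k \<in> {1..N} \<Longrightarrow> l \<in> {1..N} \<Longrightarrow>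
      i < j \<Longrightarrow> k < l \<Longrightarrow> sc r * (a i l * a j k) - sc v * (a j k * a i l) \<in> I"
    and diagonal_relation: "i \<in> {1..N} \<Longrightarrow> j \<in> {1..N} \<Longrightarrow> k \<in> {1..N} \<Longrightarrow> l \<in> {1..N} \<Longrightarrow>
      i < j \<Longrightarrow> k < l \<Longrightarrow>
      (a i k * a j l - a j l * a i k) - sc (r - inverse v) * (a i l * a j k) \<in> I"
begin

section \<open>Scalars and congruences modulo the ideal\<close>

lemma sc_0: "sc 0 = 0"
  using sc_add[of 0 0] by simp

lemma sc_minus: "sc (- z) = - sc z"
  using sc_add[of z "- z"] by (simp add: sc_0 minus_unique)

lemma sc_diff: "sc (z - z') = sc z - sc z'"
  using sc_add[of z "- z'"] by (simp add: sc_minus)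

lemma sc_sum: "sc (\<Sum>i\<in>A. f i) = (\<Sum>i\<in>A. sc (f i))"
  by (induction A rule: infinite_finite_induct) (auto simp: sc_0 sc_add)

lemma sc_left_commute: "x * (sc z * y) = sc z * (x * y)"
  by (metis mult.assoc sc_commute)

lemma C_0: "0 \<in> C" and C_1: "1 \<in> C"
  using C_sc[of 0] C_sc[of 1] by (simp_all add: sc_0 sc_1)

lemma C_diff: "x \<in> C \<Longrightarrow> y \<in> C \<Longrightarrow> x - y \<in> C"
  using C_add[of x "sc (-1) * y"] C_mult[OF C_sc, of y "-1"] by (simp add: sc_minus sc_1)

lemma C_sum: "(\<And>i. i \<in> A \<Longrightarrow> f i \<in> C) \<Longrightarrow> (\<Sum>i\<in>A. f i) \<in> C"
  by (induction A rule: infinite_finite_induct) (auto simp: C_0 C_add)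

lemma C_prod_list: "(\<And>x. x \<in> set xs \<Longrightarrow> x \<in> C) \<Longrightarrow> prod_list xs \<in> C"
  by (induction xs) (auto simp: C_1 C_mult)

definition cg :: "'a \<Rightarrow> 'a \<Rightarrow> bool" (infix "\<approx>" 50)
  where "x \<approx> y \<longleftrightarrow> x - y \<in> I"

lemma cg_refl [simp]: "x \<approx> x"
  by (simp add: cg_def I_zero)

lemma I_uminus: "x \<in> I \<Longrightarrow> - x \<in> I"
  using I_mult_left[OF _ C_sc, of x "-1"] by (simp add: sc_minus sc_1)

lemma cg_sym: "x \<approx> y \<Longrightarrow> y \<approx> x"
  unfolding cg_def using I_uminus[of "x - y"] by simp

lemma cg_trans [trans]: "x \<approx> y \<Longrightarrow> y \<approx> z \<Longrightarrow> x \<approx> z"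
  unfolding cg_def using I_add[of "x - y" "y - z"] by simp

lemma cg_eq_trans [trans]: "x \<approx> y \<Longrightarrow> y = z \<Longrightarrow> x \<approx> z"
  and eq_cg_trans [trans]: "x = y \<Longrightarrow> y \<approx> z \<Longrightarrow> x \<approx> z"
  by simp_all

lemma cg_add: "x \<approx> y \<Longrightarrow> x' \<approx> y' \<Longrightarrow> x + x' \<approx> y + y'"
  unfolding cg_def using I_add[of "x - y" "x' - y'"] by (simp add: algebra_simps)

lemma cg_mult_left: "x \<approx> y \<Longrightarrow> z \<in> C \<Longrightarrow> z * x \<approx> z * y"
  unfolding cg_def using I_mult_left[of "x - y" z] by (simp add: algebra_simps)

lemma cg_mult_right: "x \<approx> y \<Longrightarrow> z \<in> C \<Longrightarrow> x * z \<approx> y * z"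
  unfolding cg_def using I_mult_right[of "x - y" z] by (simp add: algebra_simps)

lemma cg_sum: "(\<And>i. i \<in> A \<Longrightarrow> f i \<approx> g i) \<Longrightarrow> (\<Sum>i\<in>A. f i) \<approx> (\<Sum>i\<in>A. g i)"
  by (induction A rule: infinite_finite_induct) (auto intro: cg_add)

section \<open>Ordered products of the \<delta> and their exterior relations\<close>

definition word_prod :: "nat list \<Rightarrow> nat list \<Rightarrow> 'a"
  where "word_prod w K = prod_list (map2 a w K)"

lemma word_prod_Cons [simp]: "word_prod (i # w) (k # K) = a i k * word_prod w K"
  by (simp add: word_prod_def)

lemma word_prod_append:
  "length w = length K \<Longrightarrow> word_prod (w @ w') (K @ K') = word_prod w K * word_prod w' K'"
  by (simp add: word_prod_def)

lemma word_prod_in_C: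
  assumes "set w \<subseteq> {1..N}" "set K \<subseteq> {1..N}"
  shows "word_prod w K \<in> C"
  unfolding word_prod_def
proof (rule C_prod_list)
  fix x assume "x \<in> set (map2 a w K)"
  then obtain i k where ik: "(i, k) \<in> set (zip w K)" "x = a i k"
    by auto
  then show "x \<in> C"
    using assms set_zip_leftD[OF ik(1)] set_zip_rightD[OF ik(1)] C_gen[of i k] by blast
qed

text \<open>\<open>qdet K\<close> stands for the product of the \<open>\<delta>\<^sub>k\<close> along \<open>K\<close>.\<close>

definition qdet :: "nat list \<Rightarrow> 'a"
  where "qdet K = (\<Sum>w\<in>words {1..N} (length K). sc (eps v w) * word_prod w K)"

text \<open>Reordering two neighbouring exterior generators: the term of a decreasing pair is moved
  to the increasing one at the cost of \<open>-v\<close>, and equal letters give 0. It serves both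
  for the product of two \<delta> and for collecting the coefficients of \<Omega>.\<close>

lemma sum_eps_pairs:
  "(\<Sum>i\<in>S. \<Sum>j\<in>S. sc (eps v (u @ i # j # t)) * g i j)
   = (\<Sum>i\<in>S. \<Sum>j\<in>S. if i < j then sc (eps v (u @ i # j # t)) * (g i j - sc v * g j i) else 0)"
proof -
  \<comment> \<open>\<open>h\<close> keeps the increasing pairs. \<open>h' i j\<close> is the
    contribution of the reversed pair, already rewritten for \<open>i < j\<close>, which is why it
    enters with its arguments exchanged and a swap of the two sums follows.\<close>
  define h where "h i j = (if i < j then sc (eps v (u @ i # j # t)) * g i j else 0)" for i j
  define h' where "h' i j = (if i < j then sc (eps v (u @ i # j # t)) * - (sc v * g j i) else 0)" for i j
  have "sc (eps v (u @ i # j # t)) * g i j = h i j + h' j i" for i j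
    using eps_swap[of j i v u t]
    by (cases i j rule: linorder_cases)
       (auto simp: h_def h'_def sc_0 sc_minus sc_mult sc_commute[of v] mult.assoc)
  then have "(\<Sum>i\<in>S. \<Sum>j\<in>S. sc (eps v (u @ i # j # t)) * g i j)
      = (\<Sum>i\<in>S. \<Sum>j\<in>S. h i j) + (\<Sum>i\<in>S. \<Sum>j\<in>S. h' j i)"
    by (simp add: sum.distrib)
  also have "(\<Sum>i\<in>S. \<Sum>j\<in>S. h' j i) = (\<Sum>i\<in>S. \<Sum>j\<in>S. h' i j)"
    by (rule sum.swap)
  also have "(\<Sum>i\<in>S. \<Sum>j\<in>S. h i j) + \<dots> = (\<Sum>i\<in>S. \<Sum>j\<in>S. h i j + h' i j)"
    by (simp add: sum.distrib)
  also have "\<dots> = (\<Sum>i\<in>S. \<Sum>j\<in>S. if i < j then sc (eps v (u @ i # j # t)) * (g i j - sc v * g j i) else 0)"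
    by (intro sum.cong refl) (simp add: h_def h'_def algebra_simps)
  finally show ?thesis .
qed

text \<open>Isolates two neighbouring columns: the bracket is the coefficient of
  \<open>x\<^sub>i x\<^sub>j\<close> in the product of their \<delta>. Any congruence between such
  brackets thus carries over to the whole product.\<close>

lemma qdet_split:
  "qdet (u @ x # y # t) = (\<Sum>w\<in>words {1..N} (length u). \<Sum>w'\<in>words {1..N} (length t).
     word_prod w u * (\<Sum>i\<in>{1..N}. \<Sum>j\<in>{1..N}. if i < j then sc (eps v (w @ i # j # w')) *
        (a i x * a j y - sc v * (a j x * a i y)) else 0) * word_prod w' t)"
proof -
  let ?S = "{1..N}"
  have "qdet (u @ x # y # t) = (\<Sum>w\<in>words ?S (length u). \<Sum>i\<in>?S. \<Sum>j\<in>?S. \<Sum>w'\<in>words ?S (length t).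
     sc (eps v (w @ i # j # w')) * word_prod (w @ i # j # w') (u @ x # y # t))"
  proof -
    have "length (u @ x # y # t) = length u + Suc (Suc (length t))"
      by simp
    then show ?thesis
      unfolding qdet_def by (simp only: sum_words_add sum_words_Suc finite_atLeastAtMost)
  qed
  also have "\<dots> = (\<Sum>w\<in>words ?S (length u). \<Sum>i\<in>?S. \<Sum>j\<in>?S. \<Sum>w'\<in>words ?S (length t).
     word_prod w u * (sc (eps v (w @ i # j # w')) * (a i x * a j y)) * word_prod w' t)"
    by (intro sum.cong refl) (auto simp: words_def word_prod_append sc_left_commute mult.assoc)
  also have "\<dots> = (\<Sum>w\<in>words ?S (length u). \<Sum>w'\<in>words ?S (length t). \<Sum>i\<in>?S. \<Sum>j\<in>?S.
     word_prod w u * (sc (eps v (w @ i # j # w')) * (a i x * a j y)) * word_prod w' t)"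
    by (simp only: sum.swap[where A = "words ?S (length t)"])
  also have "\<dots> = (\<Sum>w\<in>words ?S (length u). \<Sum>w'\<in>words ?S (length t).
     word_prod w u * (\<Sum>i\<in>?S. \<Sum>j\<in>?S. sc (eps v (w @ i # j # w')) * (a i x * a j y)) * word_prod w' t)"
    by (simp add: sum_distrib_left sum_distrib_right)
  finally show ?thesis
    by (simp only: sum_eps_pairs)
qed

text \<open>The relation that \<delta> squares to zero: for equal columns the bracket of
  \<open>qdet_split\<close> is the left side of \<open>column_relation\<close>.\<close>

lemma qdet_dup:
  assumes "set (u @ k # t) \<subseteq> {1..N}"
  shows "qdet (u @ k # k # t) \<approx> 0"
proof -
  have "qdet (u @ k # k # t) \<approx> (\<Sum>w\<in>words {1..N} (length u). \<Sum>w'\<in>words {1..N} (length t).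
     word_prod w u * (\<Sum>i\<in>{1..N}. \<Sum>j\<in>{1..N}. if i < j then sc (eps v (w @ i # j # w')) * 0 else 0)
       * word_prod w' t)"
    unfolding qdet_split
    using assms column_relation
    by (intro cg_sum cg_mult_left cg_mult_right word_prod_in_C)
       (auto simp: words_def C_sc cg_def I_zero intro!: I_mult_left)
  then show ?thesis by (simp cong: if_cong)
qed

text \<open>The relation \<open>\<delta>\<^sub>l \<delta>\<^sub>k = -v \<delta>\<^sub>k
  \<delta>\<^sub>l\<close>, checked on the coefficient of each \<open>x\<^sub>i x\<^sub>j\<close>
  with \<open>i < j\<close>.\<close>

lemma qdet_swap:
  assumes "set (u @ k # l # t) \<subseteq> {1..N}" "k < l"
  shows "qdet (u @ l # k # t) \<approx> sc (- v) * qdet (u @ k # l # t)"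
proof -
  have *: "a i l * a j k - sc v * (a j l * a i k) \<approx>
      sc (- v) * (a i k * a j l - sc v * (a j k * a i l))"
    if ij: "i \<in> {1..N}" "j \<in> {1..N}" "i < j" for i j
  proof -
    have kl: "k \<in> {1..N}" "l \<in> {1..N}" using assms by auto
    let ?d = "(a i k * a j l - a j l * a i k) - sc (r - inverse v) * (a i l * a j k)"
    let ?e = "sc r * (a i l * a j k) - sc v * (a j k * a i l)"
    have "sc v * sc (inverse v) = 1"
      using v_nonzero by (simp add: sc_1 flip: sc_mult)
    then have "sc v * (sc (inverse v) * x) = x" for x
      by (simp flip: mult.assoc)
    \<comment> \<open>Scaling both relations by \<open>v\<close> makes the two terms in
      \<open>r\<close> cancel, while the \<open>inverse v\<close> in \<open>?d\<close> becomes the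
      coefficient 1 of \<open>a i l * a j k\<close>.\<close>
    then have "a i l * a j k - sc v * (a j l * a i k) - sc (- v) * (a i k * a j l - sc v * (a j k * a i l))
      = sc v * ?d + sc v * ?e"
      by (simp add: algebra_simps sc_minus sc_diff)
    moreover have "sc v * ?d + sc v * ?e \<in> I"
      by (intro I_add I_mult_left C_sc diagonal_relation antidiagonal_relation ij kl assms(2))
    ultimately show ?thesis
      by (simp add: cg_def)
  qed
  have **: "(\<Sum>i\<in>S. \<Sum>j\<in>S. if i < j then sc (e i j) * (sc z * g i j) else 0)
      = sc z * (\<Sum>i\<in>S. \<Sum>j\<in>S. if i < j then sc (e i j) * g i j else 0)"
    for S :: "nat set" and e :: "nat \<Rightarrow> nat \<Rightarrow> complex" and z and g :: "nat \<Rightarrow> nat \<Rightarrow> 'a"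
    unfolding sum_distrib_left
    by (intro sum.cong refl) (simp add: sc_left_commute[where z = z])
  have "qdet (u @ l # k # t) \<approx> (\<Sum>w\<in>words {1..N} (length u). \<Sum>w'\<in>words {1..N} (length t).
     word_prod w u * (\<Sum>i\<in>{1..N}. \<Sum>j\<in>{1..N}. if i < j then sc (eps v (w @ i # j # w')) *
       (sc (- v) * (a i k * a j l - sc v * (a j k * a i l))) else 0) * word_prod w' t)"
    unfolding qdet_split
    using assms
    by (intro cg_sum cg_mult_left cg_mult_right word_prod_in_C)
       (auto simp: words_def C_sc intro!: cg_mult_left *)
  also have "\<dots> = sc (- v) * qdet (u @ k # l # t)"
    unfolding qdet_split sum_distrib_left[where A = "words _ _"]
    by (intro sum.cong refl) (simp only: ** mult.assoc sc_left_commute[of "word_prod _ _"])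
  finally show ?thesis .
qed

text \<open>Bubble sort on the columns. Exchanging a strict descent lowers \<open>linv\<close> even
  if letters repeat elsewhere, so the induction covers all words; a repetition ends in
  \<open>qdet_dup\<close>, where \<open>eps\<close> is 0 as well.\<close>

lemma qdet_eps:
  assumes "K \<in> words {1..N} N"
  shows "qdet K \<approx> sc (eps v K) * qdet [1..<N + 1]"
  using assms
proof (induction "linv K" arbitrary: K rule: less_induct)
  case less
  have K: "set K \<subseteq> {1..N}" "length K = N"
    using less.prems by (auto simp: words_def)
  show ?case
  proof (cases "sorted_wrt (<) K")
    case True
    then have *: "sorted K" "distinct K"
      by (simp_all add: strict_sorted_iff)
    \<comment> \<open>A strictly increasing word of length \<open>N\<close> over
      \<open>{1..N}\<close> uses every letter, so it is the standard one.\<close>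
    then have "set K = {1..N}"
      using K by (intro card_subset_eq) (auto simp: distinct_card)
    then have "K = [1..<N + 1]"
      by (intro sorted_distinct_set_unique[OF *])
         (simp_all add: atLeastLessThanSuc_atLeastAtMost del: upt_Suc)
    then show ?thesis
      using * by (simp add: eps_def linv_sorted sc_1 del: upt_Suc)
  next
    case False
    then obtain u x y t where uxyt: "K = u @ x # y # t" "y \<le> x"
      by (rule exists_adjacent_descent)
    show ?thesis
    proof (cases "x = y")
      case True
      then show ?thesis
        using qdet_dup[of u x t] K by (simp add: uxyt sc_0)
    next
      case False
      then have "y < x" using uxyt by simp
      then have "qdet K \<approx> sc (- v) * qdet (u @ y # x # t)"
        using qdet_swap[of u y x t] K by (simp add: uxyt)
      also have "\<dots> \<approx> sc (- v) * (sc (eps v (u @ y # x # t)) * qdet [1..<N + 1])"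
        using K \<open>y < x\<close> by (intro cg_mult_left less.hyps C_sc) (auto simp: uxyt linv_swap words_def)
      also have "\<dots> = sc (eps v K) * qdet [1..<N + 1]"
        by (simp only: uxyt eps_swap[OF \<open>y < x\<close>] sc_mult mult.assoc)
      finally show ?thesis .
    qed
  qed
qed

text \<open>\<open>half_entry n i j\<close> is the coefficient of \<open>x\<^sub>i x\<^sub>j\<close> in \<open>\<Omega>\<close> before reordering, \<open>pf_entry n i j\<close> the
  one after collecting the terms with \<open>i < j\<close>.\<close>

definition half_entry :: "nat \<Rightarrow> nat \<Rightarrow> nat \<Rightarrow> 'a"
  where "half_entry n i j = (\<Sum>m\<in>{1..n}. a i (2 * m - 1) * a j (2 * m))"

definition pf_entry :: "nat \<Rightarrow> nat \<Rightarrow> nat \<Rightarrow> 'a"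
  where "pf_entry n i j = (\<Sum>m\<in>{1..n}. a i (2 * m - 1) * a j (2 * m) - sc r * (a i (2 * m) * a j (2 * m - 1)))"

text \<open>The antidiagonal relation in the columns \<open>2 * m - 1\<close> and
  \<open>2 * m\<close> trades the factor \<open>v\<close> of the reversed term for \<open>r\<close>.
  This is how the parameter \<open>r\<close> of \<open>JJ r\<close> fits the parameter
  \<open>v\<close> of the Pfaffian.\<close>

lemma pf_entry_cong:
  assumes "N = 2 * n" "i \<in> {1..N}" "j \<in> {1..N}" "i < j"
  shows "half_entry n i j - sc v * half_entry n j i \<approx> pf_entry n i j"
proof -
  have "half_entry n i j - sc v * half_entry n j i
    = (\<Sum>m\<in>{1..n}. a i (2 * m - 1) * a j (2 * m) - sc v * (a j (2 * m - 1) * a i (2 * m)))"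
    by (simp add: half_entry_def sum_subtractf sum_distrib_left)
  also have "\<dots> \<approx> pf_entry n i j"
    unfolding pf_entry_def
  proof (rule cg_sum)
    fix m assume m: "m \<in> {1..n}"
    have "sc r * (a i (2 * m) * a j (2 * m - 1)) - sc v * (a j (2 * m - 1) * a i (2 * m)) \<in> I"
      using m assms by (intro antidiagonal_relation) auto
    then show "a i (2 * m - 1) * a j (2 * m) - sc v * (a j (2 * m - 1) * a i (2 * m)) \<approx>
       a i (2 * m - 1) * a j (2 * m) - sc r * (a i (2 * m) * a j (2 * m - 1))"
      by (simp add: cg_def)
  qed
  finally show ?thesis .
qed

section \<open>The power of \<Omega>, expanded in two ways\<close>

lemma half_entry_in_C: "N = 2 * n \<Longrightarrow> i \<in> {1..N} \<Longrightarrow> j \<in> {1..N} \<Longrightarrow> half_entry n i j \<in> C"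
  unfolding half_entry_def by (intro C_sum C_mult C_gen) auto

lemma pf_entry_in_C: "N = 2 * n \<Longrightarrow> i \<in> {1..N} \<Longrightarrow> j \<in> {1..N} \<Longrightarrow> pf_entry n i j \<in> C"
  unfolding pf_entry_def by (intro C_sum C_diff C_mult C_gen C_sc) auto

lemma pair_prod_pf_entry_in_C: "N = 2 * n \<Longrightarrow> set w \<subseteq> {1..N} \<Longrightarrow> pair_prod (pf_entry n) w \<in> C"
  unfolding pair_prod_def
  by (rule C_prod_list) (auto dest!: set_pairs intro!: pf_entry_in_C)

text \<open>Distributivity: every pair of letters of \<open>w\<close> chooses its block of columns
  independently of the others.\<close>

lemma sum_word_prod_doubled:
  "length w = 2 * k \<Longrightarrow>
    (\<Sum>ms\<in>words {1..n} k. word_prod w (doubled ms)) = pair_prod (half_entry n) w"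
proof (induction k arbitrary: w)
  case 0
  then show ?case by (simp add: word_prod_def)
next
  case (Suc k)
  then obtain i j w' where w: "w = i # j # w'" "length w' = 2 * k"
    by (auto simp: length_Suc_conv)
  then show ?case
    by (simp add: sum_words_Suc half_entry_def[of n i j] mult.assoc Suc.IH[unfolded One_nat_def] sum_distrib_right
        flip: sum_distrib_left)
qed

text \<open>Replaces the entries one pair at a time. The prefix \<open>u\<close> stays general
  because \<open>eps\<close> does not factor over a concatenation: a pair that is split off has to
  remain visible to it.\<close>

lemma sum_pair_prod_cong:
  assumes N: "N = 2 * n"
  shows "(\<Sum>w\<in>words {1..N} (2 * k). sc (eps v (u @ w)) * pair_prod (half_entry n) w) \<approx>
    (\<Sum>w\<in>words {1..N} (2 * k).
       if ascending_pairs w then sc (eps v (u @ w)) * pair_prod (pf_entry n) w else 0)"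
proof (induction k arbitrary: u)
  case (Suc k)
  let ?S = "{1..N}" and ?W = "words {1..N} (2 * k)"
  let ?b = "pf_entry n" and ?c = "half_entry n"
  have "(\<Sum>w\<in>words ?S (2 * Suc k). sc (eps v (u @ w)) * pair_prod ?c w)
      = (\<Sum>i\<in>?S. \<Sum>j\<in>?S. ?c i j * (\<Sum>w\<in>?W. sc (eps v ((u @ [i, j]) @ w)) * pair_prod ?c w))"
    by (simp add: sum_words_Suc sum_distrib_left sc_left_commute[of "half_entry _ _ _"])
  \<comment> \<open>The tail comes first: for fixed \<open>i\<close> and \<open>j\<close> the
    induction hypothesis is used with the prefix \<open>u @ [i, j]\<close>.\<close>
  also have "\<dots> \<approx> (\<Sum>i\<in>?S. \<Sum>j\<in>?S. ?c i j * (\<Sum>w\<in>?W.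
      if ascending_pairs w then sc (eps v ((u @ [i, j]) @ w)) * pair_prod ?b w else 0))"
    by (intro cg_sum cg_mult_left Suc.IH half_entry_in_C N)
  also have "\<dots> = (\<Sum>i\<in>?S. \<Sum>j\<in>?S. \<Sum>w\<in>?W.
      if ascending_pairs w then sc (eps v (u @ i # j # w)) * ?c i j * pair_prod ?b w else 0)"
    unfolding sum_distrib_left
    by (intro sum.cong refl) (simp add: sc_left_commute[of "half_entry _ _ _"] mult.assoc)
  also have "\<dots> = (\<Sum>w\<in>?W. \<Sum>i\<in>?S. \<Sum>j\<in>?S.
      if ascending_pairs w then sc (eps v (u @ i # j # w)) * ?c i j * pair_prod ?b w else 0)"
    by (simp only: sum.swap[where B = ?W])
  also have "\<dots> = (\<Sum>w\<in>?W. if ascending_pairs w then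
      (\<Sum>i\<in>?S. \<Sum>j\<in>?S. sc (eps v (u @ i # j # w)) * ?c i j) * pair_prod ?b w else 0)"
    by (intro sum.cong refl) (simp add: sum_distrib_right)
  \<comment> \<open>With the tail now fixed outside, the first pair is collected into its increasing
    form.\<close>
  also have "\<dots> = (\<Sum>w\<in>?W. if ascending_pairs w then
      (\<Sum>i\<in>?S. \<Sum>j\<in>?S. if i < j then sc (eps v (u @ i # j # w)) * (?c i j - sc v * ?c j i) else 0)
        * pair_prod ?b w else 0)"
    by (simp only: sum_eps_pairs)
  also have "\<dots> \<approx> (\<Sum>w\<in>?W. if ascending_pairs w then
      (\<Sum>i\<in>?S. \<Sum>j\<in>?S. if i < j then sc (eps v (u @ i # j # w)) * ?b i j else 0)
        * pair_prod ?b w else 0)"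
  proof (rule cg_sum)
    fix w assume "w \<in> ?W"
    then have "(\<Sum>i\<in>?S. \<Sum>j\<in>?S. if i < j then sc (eps v (u @ i # j # w)) * (?c i j - sc v * ?c j i) else 0)
        * pair_prod ?b w \<approx>
      (\<Sum>i\<in>?S. \<Sum>j\<in>?S. if i < j then sc (eps v (u @ i # j # w)) * ?b i j else 0) * pair_prod ?b w"
      by (intro cg_mult_right cg_sum pair_prod_pf_entry_in_C N)
         (auto simp: words_def C_sc intro!: cg_mult_left pf_entry_cong N)
    then show "(if ascending_pairs w then
      (\<Sum>i\<in>?S. \<Sum>j\<in>?S. if i < j then sc (eps v (u @ i # j # w)) * (?c i j - sc v * ?c j i) else 0)
        * pair_prod ?b w else 0) \<approx> (if ascending_pairs w then
      (\<Sum>i\<in>?S. \<Sum>j\<in>?S. if i < j then sc (eps v (u @ i # j # w)) * ?b i j else 0)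
        * pair_prod ?b w else 0)"
      by simp
  qed
  also have "\<dots> = (\<Sum>w\<in>?W. \<Sum>i\<in>?S. \<Sum>j\<in>?S. if ascending_pairs (i # j # w)
      then sc (eps v (u @ i # j # w)) * pair_prod ?b (i # j # w) else 0)"
  proof (rule sum.cong[OF refl])
    fix w
    show "(if ascending_pairs w then
      (\<Sum>i\<in>?S. \<Sum>j\<in>?S. if i < j then sc (eps v (u @ i # j # w)) * ?b i j else 0)
        * pair_prod ?b w else 0) = (\<Sum>i\<in>?S. \<Sum>j\<in>?S. if ascending_pairs (i # j # w)
      then sc (eps v (u @ i # j # w)) * pair_prod ?b (i # j # w) else 0)"
    proof (cases "ascending_pairs w")
      case True
      show ?thesis
        unfolding if_P[OF True] sum_distrib_right
        by (intro sum.cong refl) (simp add: True mult.assoc)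
    qed simp
  qed
  also have "\<dots> = (\<Sum>i\<in>?S. \<Sum>j\<in>?S. \<Sum>w\<in>?W. if ascending_pairs (i # j # w)
      then sc (eps v (u @ i # j # w)) * pair_prod ?b (i # j # w) else 0)"
    by (simp only: sum.swap[where A = ?W])
  also have "\<dots> = (\<Sum>w\<in>words ?S (2 * Suc k).
       if ascending_pairs w then sc (eps v (u @ w)) * pair_prod ?b w else 0)"
    by (simp add: sum_words_Suc del: ascending_pairs_simps pair_prod_simps)
  finally show ?case .
qed simp

text \<open>The total coefficient of the ordered product of all \<delta> in the power of \<Omega>;
  only choices of pairwise different blocks survive.\<close>

lemma sum_eps_doubled: "(\<Sum>ms\<in>words {1..n} n. eps v (doubled ms)) = qfact (v ^ 4) n"
proof -
  have "(\<Sum>ms\<in>words {1..n} n. eps v (doubled ms))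
      = (\<Sum>ms\<in>words {1..n} n. if distinct ms then (v ^ 4) ^ linv ms else 0)"
    by (intro sum.cong refl eps_doubled) (auto simp: words_def)
  also have "\<dots> = (\<Sum>ms\<in>permutations_of_set {1..n}. (v ^ 4) ^ linv ms)"
    unfolding permutations_of_set_eq_words
    by (simp add: sum.inter_filter finite_words)
  finally show ?thesis
    by (simp add: sum_power_linv_permutations_of_set)
qed

text \<open>The sum of \<open>qdet (doubled ms)\<close> in the middle is the top coefficient of the
  power of \<Omega>. Sorting columns leads from it to the left side, summing over the blocks first
  leads to the right side.\<close>

lemma qfact_qdet_cong:
  assumes N: "N = 2 * n"
  shows "sc (qfact (v ^ 4) n) * qdet [1..<N + 1] \<approx>
    (\<Sum>w\<in>words {1..N} N.
       if ascending_pairs w then sc (eps v w) * pair_prod (pf_entry n) w else 0)"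
proof -
  have "sc (qfact (v ^ 4) n) * qdet [1..<N + 1]
      = (\<Sum>ms\<in>words {1..n} n. sc (eps v (doubled ms)) * qdet [1..<N + 1])"
    by (simp only: sc_sum sum_distrib_right flip: sum_eps_doubled)
  also have "\<dots> \<approx> (\<Sum>ms\<in>words {1..n} n. qdet (doubled ms))"
  proof (intro cg_sum cg_sym[OF qdet_eps])
    fix ms assume "ms \<in> words {1..n} n"
    then have ms: "set ms \<subseteq> {1..n}" "length ms = n" by (auto simp: words_def)
    have "{2 * m - 1, 2 * m} \<subseteq> {1..N}" if "m \<in> set ms" for m
    proof -
      have "m \<in> {1..n}" using ms(1) that by blast
      then show ?thesis by (auto simp: N)
    qed
    then show "doubled ms \<in> words {1..N} N"
      using ms(2) unfolding words_def set_doubled by (auto simp: set_doubled N)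
  qed
  also have "\<dots> = (\<Sum>ms\<in>words {1..n} n. \<Sum>w\<in>words {1..N} N. sc (eps v w) * word_prod w (doubled ms))"
  proof (rule sum.cong[OF refl])
    fix ms assume "ms \<in> words {1..n} n"
    then have "length (doubled ms) = N" by (simp add: words_def N)
    then show "qdet (doubled ms) = (\<Sum>w\<in>words {1..N} N. sc (eps v w) * word_prod w (doubled ms))"
      by (simp only: qdet_def)
  qed
  also have "\<dots> = (\<Sum>w\<in>words {1..N} N. \<Sum>ms\<in>words {1..n} n. sc (eps v w) * word_prod w (doubled ms))"
    by (rule sum.swap)
  also have "\<dots> = (\<Sum>w\<in>words {1..N} N. sc (eps v w) * pair_prod (half_entry n) w)"
  proof (rule sum.cong[OF refl])
    fix w assume "w \<in> words {1..N} N"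
    then have "length w = 2 * n" by (simp add: words_def N)
    then show "(\<Sum>ms\<in>words {1..n} n. sc (eps v w) * word_prod w (doubled ms)) =
        sc (eps v w) * pair_prod (half_entry n) w"
      by (simp only: sum_word_prod_doubled flip: sum_distrib_left)
  qed
  also have "\<dots> \<approx> (\<Sum>w\<in>words {1..N} N.
       if ascending_pairs w then sc (eps v w) * pair_prod (pf_entry n) w else 0)"
    using sum_pair_prod_cong[OF N, where k = n and u = "[]"]
    by (simp only: N append_Nil)
  finally show ?thesis .
qed

section \<open>From words back to permutations and matrix entries\<close>

lemma qdet_upt:
  "qdet [1..<N + 1] = (\<Sum>\<sigma>\<in>{\<sigma>. \<sigma> permutes {1..N}}.
     sc ((- v) ^ inversions {1..N} \<sigma>) * prod_list (map (\<lambda>k. a (\<sigma> k) k) [1..<N + 1]))"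
proof -
  have word_prod_map: "word_prod (map \<sigma> xs) xs = prod_list (map (\<lambda>k. a (\<sigma> k) k) xs)"
    for \<sigma> and xs :: "nat list"
    by (induction xs) (simp_all add: word_prod_def)
  have "qdet [1..<N + 1] = (\<Sum>w\<in>words {1..N} N.
      if distinct w then sc ((- v) ^ linv w) * word_prod w [1..<N + 1] else 0)"
  proof -
    have len: "length [1..<N + 1] = N" by simp
    show ?thesis
      unfolding qdet_def len
      by (intro sum.cong refl) (simp add: eps_def sc_0 del: upt_Suc)
  qed
  \<comment> \<open>Row words with a repeated letter have weight 0; the others are the one-line
    words of permutations.\<close>
  also have "\<dots> = (\<Sum>w\<in>permutations_of_set {1..N}. sc ((- v) ^ linv w) * word_prod w [1..<N + 1])"
    unfolding permutations_of_set_eq_words by (rule sum.inter_filter[OF finite_words, symmetric]) simp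
  also have "\<dots> = (\<Sum>\<sigma>\<in>{\<sigma>. \<sigma> permutes {1..N}}.
      sc ((- v) ^ linv (map \<sigma> [1..<N + 1])) * word_prod (map \<sigma> [1..<N + 1]) [1..<N + 1])"
    by (rule sum.reindex_bij_betw[OF bij_betw_permutes_permutations_of_set, symmetric])
  finally show ?thesis
    by (simp only: inversions_eq_linv word_prod_map)
qed

lemma sum_ascending_pairs:
  assumes N: "N = 2 * n"
  shows "(\<Sum>w\<in>words {1..N} N. if ascending_pairs w then sc (eps v w) * pair_prod f w else 0) =
    (\<Sum>\<sigma>\<in>Pf_perms n. sc ((- v) ^ inversions {1..2 * n} \<sigma>) *
       prod_list (map (\<lambda>i. f (\<sigma> (2 * i - 1)) (\<sigma> (2 * i))) [1..<n + 1]))"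
proof -
  have asc: "ascending_pairs (map \<sigma> [1..<N + 1]) \<longleftrightarrow> (\<forall>i\<in>{1..n}. \<sigma> (2 * i - 1) < \<sigma> (2 * i))" for \<sigma>
    unfolding ascending_pairs_def N pairs_map_upt
    by (simp add: atLeastLessThanSuc_atLeastAtMost del: upt_Suc)
  have "(\<Sum>w\<in>words {1..N} N. if ascending_pairs w then sc (eps v w) * pair_prod f w else 0)
     = (\<Sum>w\<in>words {1..N} N. if distinct w then
         (if ascending_pairs w then sc ((- v) ^ linv w) * pair_prod f w else 0) else 0)"
    by (intro sum.cong refl) (simp add: eps_def sc_0)
  also have "\<dots> = (\<Sum>w\<in>permutations_of_set {1..N}.
      if ascending_pairs w then sc ((- v) ^ linv w) * pair_prod f w else 0)"
    unfolding permutations_of_set_eq_words by (simp add: sum.inter_filter finite_words)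
  also have "\<dots> = (\<Sum>\<sigma>\<in>{\<sigma>. \<sigma> permutes {1..N}}. if ascending_pairs (map \<sigma> [1..<N + 1])
      then sc ((- v) ^ linv (map \<sigma> [1..<N + 1])) * pair_prod f (map \<sigma> [1..<N + 1]) else 0)"
    by (rule sum.reindex_bij_betw[OF bij_betw_permutes_permutations_of_set, symmetric])
  also have "\<dots> = (\<Sum>\<sigma>\<in>Pf_perms n.
      sc ((- v) ^ linv (map \<sigma> [1..<N + 1])) * pair_prod f (map \<sigma> [1..<N + 1]))"
  proof -
    have "Pf_perms n = {\<sigma>\<in>{\<sigma>. \<sigma> permutes {1..N}}. ascending_pairs (map \<sigma> [1..<N + 1])}"
      unfolding Pf_perms_def asc by (simp add: N)
    moreover have "finite {\<sigma>. \<sigma> permutes {1..N}}"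
      by (simp add: finite_permutations)
    ultimately show ?thesis
      by (simp only: sum.inter_filter)
  qed
  finally show ?thesis
    unfolding N inversions_eq_linv pair_prod_def pairs_map_upt
    by (simp only: map_map o_def case_prod_conv)
qed

text \<open>Each column of \<open>JJ r\<close> has a single nonzero entry: multiplication by it
  moves column \<open>2 * m - 1\<close> to place \<open>2 * m\<close> and puts \<open>-r\<close>
  times column \<open>2 * m\<close> in place \<open>2 * m - 1\<close>.\<close>

lemma sum_JJ:
  assumes N: "N = 2 * n"
  shows "(\<Sum>k\<in>{1..N}. (\<Sum>l\<in>{1..N}. a i l * sc (JJ r l k)) * a j k) = pf_entry n i j"
proof -
  have pairs: "(\<Sum>k\<in>{1..2 * n}. f k) = (\<Sum>m\<in>{1..n}. f (2 * m) + f (2 * m - 1))"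
    for f :: "nat \<Rightarrow> 'a" and n
    by (induction n) (simp_all add: add_ac)
  have even: "(\<Sum>l\<in>{1..N}. a i l * sc (JJ r l (2 * m))) = a i (2 * m - 1)"
    if m: "m \<in> {1..n}" for m
  proof -
    have "JJ r l (2 * m) = (if l = 2 * m - 1 then 1 else 0)" for l
      using m by (auto simp: JJ_def)
    then have "(\<Sum>l\<in>{1..N}. a i l * sc (JJ r l (2 * m)))
        = (\<Sum>l\<in>{1..N}. if l = 2 * m - 1 then a i l else 0)"
      by (intro sum.cong refl) (simp add: sc_0 sc_1)
    moreover have "2 * m - 1 \<in> {1..N}" using m by (auto simp: N)
    ultimately show ?thesis by simp
  qed
  have odd: "(\<Sum>l\<in>{1..N}. a i l * sc (JJ r l (2 * m - 1))) = - (sc r * a i (2 * m))"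
    if m: "m \<in> {1..n}" for m
  proof -
    have "JJ r l (2 * m - 1) = (if l = 2 * m then - r else 0)" for l
      using m by (auto simp: JJ_def; presburger)
    then have "(\<Sum>l\<in>{1..N}. a i l * sc (JJ r l (2 * m - 1)))
        = (\<Sum>l\<in>{1..N}. if l = 2 * m then - (sc r * a i l) else 0)"
      by (intro sum.cong refl) (simp add: sc_0 sc_minus sc_commute)
    moreover have "2 * m \<in> {1..N}" using m by (auto simp: N)
    ultimately show ?thesis by simp
  qed
  have "(\<Sum>k\<in>{1..N}. (\<Sum>l\<in>{1..N}. a i l * sc (JJ r l k)) * a j k)
     = (\<Sum>m\<in>{1..n}. (\<Sum>l\<in>{1..N}. a i l * sc (JJ r l (2 * m))) * a j (2 * m) +
         (\<Sum>l\<in>{1..N}. a i l * sc (JJ r l (2 * m - 1))) * a j (2 * m - 1))"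
    using pairs[where n = n] by (simp only: N)
  also have "\<dots> = pf_entry n i j"
    unfolding pf_entry_def
    by (intro sum.cong refl) (simp only: even odd, simp add: mult.assoc)
  finally show ?thesis .
qed

end

section \<open>Free and presented algebras\<close>

lemma carrier_free_algebra:
  "p \<in> carrier (free_algebra X) \<longleftrightarrow> (\<forall>w\<in>Poly_Mapping.keys p. set (letters w) \<subseteq> X)"
  by (simp add: free_algebra_def)

lemma free_algebra_simps [simp]:
  "\<zero>\<^bsub>free_algebra X\<^esub> = 0" "\<one>\<^bsub>free_algebra X\<^esub> = 1"
  "p \<oplus>\<^bsub>free_algebra X\<^esub> q = p + q" "p \<otimes>\<^bsub>free_algebra X\<^esub> q = p * q"
  by (simp_all add: free_algebra_def)

lemma free_algebra_closed:
  shows "p \<in> carrier (free_algebra X) \<Longrightarrow> q \<in> carrier (free_algebra X) \<Longrightarrow> p + q \<in> carrier (free_algebra X)"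
    and "p \<in> carrier (free_algebra X) \<Longrightarrow> q \<in> carrier (free_algebra X) \<Longrightarrow> p - q \<in> carrier (free_algebra X)"
    and "p \<in> carrier (free_algebra X) \<Longrightarrow> q \<in> carrier (free_algebra X) \<Longrightarrow> p * q \<in> carrier (free_algebra X)"
    and "0 \<in> carrier (free_algebra X)"
    and "scal z \<in> carrier (free_algebra X)"
    and "x \<in> X \<Longrightarrow> var x \<in> carrier (free_algebra X)"
proof -
  show "p + q \<in> carrier (free_algebra X)" "p - q \<in> carrier (free_algebra X)"
    if "p \<in> carrier (free_algebra X)" "q \<in> carrier (free_algebra X)"
    using that Poly_Mapping.keys_add[of p q] keys_diff[of p q] by (auto simp: carrier_free_algebra)
  show "p * q \<in> carrier (free_algebra X)"
    if "p \<in> carrier (free_algebra X)" "q \<in> carrier (free_algebra X)"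
    unfolding carrier_free_algebra
  proof
    fix w assume "w \<in> Poly_Mapping.keys (p * q)"
    then obtain u t where "w = u + t" "u \<in> Poly_Mapping.keys p" "t \<in> Poly_Mapping.keys q"
      using keys_mult[of p q] by auto
    then show "set (letters w) \<subseteq> X"
      using that by (auto simp: carrier_free_algebra plus_free_word_def)
  qed
qed (auto simp: carrier_free_algebra scal_def var_def zero_free_word_def)

lemma free_algebra_one_closed: "1 \<in> carrier (free_algebra X)"
  using free_algebra_closed(5)[of 1] by (simp add: scal_def)

lemma ring_free_algebra: "ring (free_algebra X)"
proof (rule ringI)
  show "abelian_group (free_algebra X)"
  proof (rule abelian_groupI)
    fix p assume "p \<in> carrier (free_algebra X)"
    then have "0 - p \<in> carrier (free_algebra X)"
      by (intro free_algebra_closed)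
    then show "\<exists>q\<in>carrier (free_algebra X). q \<oplus>\<^bsub>free_algebra X\<^esub> p = \<zero>\<^bsub>free_algebra X\<^esub>"
      by (intro bexI[of _ "- p"]) auto
  qed (auto simp: free_algebra_closed)
  show "Group.monoid (free_algebra X)"
    by (rule monoidI) (auto simp: free_algebra_closed free_algebra_one_closed mult.assoc)
qed (auto simp: algebra_simps)

lemma free_algebra_minus:
  assumes "p \<in> carrier (free_algebra X)" "q \<in> carrier (free_algebra X)"
  shows "p \<ominus>\<^bsub>free_algebra X\<^esub> q = p - q"
proof -
  interpret ring "free_algebra X" by (rule ring_free_algebra)
  have "\<ominus>\<^bsub>free_algebra X\<^esub> q = - q"
    using assms free_algebra_closed(2)[OF free_algebra_closed(4) assms(2)]
    by (intro minus_equality) auto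
  then show ?thesis by (simp add: a_minus_def)
qed

text \<open>For an infinite index set both sums take the default value 0.\<close>

lemma finsum_free_algebra:
  "f \<in> A \<rightarrow> carrier (free_algebra X) \<Longrightarrow> finsum (free_algebra X) f A = sum f A"
proof -
  interpret ring "free_algebra X" by (rule ring_free_algebra)
  show "f \<in> A \<rightarrow> carrier (free_algebra X) \<Longrightarrow> finsum (free_algebra X) f A = sum f A"
    by (induction A rule: infinite_finite_induct) (auto simp: Pi_def)
qed

lemma scal_add: "scal (z + z') = scal z + scal z'"
  by (simp add: scal_def single_add)

lemma scal_mult: "scal (z * z') = scal z * scal z'"
  by (simp add: scal_def mult_single)

lemma scal_1: "scal 1 = 1"
  by (simp add: scal_def)

lemma scal_minus: "scal (- z) = - scal z"
  by (simp add: scal_def single_uminus)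

text \<open>A constant is supported on the empty word, which is neutral on both sides, so it
  commutes with each single term. The induction adds the terms of \<open>p\<close> one by
  one.\<close>

lemma scal_commute: "scal z * p = p * scal z"
proof (induction p rule: update_induct)
  case (update f w c)
  have "Poly_Mapping.update w c f = f + Poly_Mapping.single w c"
    using update(1)
    by (intro poly_mapping_eqI) (auto simp: lookup_update lookup_add lookup_single in_keys_iff when_def)
  then show ?case
    using update(3) by (simp add: scal_def algebra_simps mult_single)
qed simp

section \<open>Passage between the quotient algebra and representatives in the free algebra\<close>

locale presentation =
  fixes X :: "'x set" and S :: "'x free_alg set"
  assumes relations_closed: "S \<subseteq> carrier (free_algebra X)"
begin

abbreviation "F \<equiv> free_algebra X"
abbreviation "J \<equiv> genideal F S"
abbreviation "R \<equiv> presented_algebra X S"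
abbreviation proj where "proj p \<equiv> J +>\<^bsub>F\<^esub> p"

sublocale F: ring F
  by (rule ring_free_algebra)

sublocale J: ideal J F
  by (rule F.genideal_ideal[OF relations_closed])

lemma presented_algebra_simps:
  "carrier R = carrier (F Quot J)" "x \<oplus>\<^bsub>R\<^esub> y = x \<oplus>\<^bsub>F Quot J\<^esub> y" "x \<otimes>\<^bsub>R\<^esub> y = x \<otimes>\<^bsub>F Quot J\<^esub> y"
  "\<zero>\<^bsub>R\<^esub> = \<zero>\<^bsub>F Quot J\<^esub>" "\<one>\<^bsub>R\<^esub> = \<one>\<^bsub>F Quot J\<^esub>" "c \<odot>\<^bsub>R\<^esub> x = proj (scal c) \<otimes>\<^bsub>R\<^esub> x"
  by (simp_all add: presented_algebra_def Let_def ring.defs module.defs)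

sublocale Q: ring "F Quot J"
  by (rule J.quotient_is_ring)

text \<open>\<open>R\<close> extends the quotient record by a scalar action and so has another
  record type; the axioms are read off from the quotient, whose ring operations it shares.\<close>

lemma ring_presented_algebra: "ring R"
proof (rule ringI)
  show "abelian_group R"
  proof (rule abelian_groupI)
    fix x assume "x \<in> carrier R"
    then have "\<ominus>\<^bsub>F Quot J\<^esub> x \<in> carrier R" "\<ominus>\<^bsub>F Quot J\<^esub> x \<oplus>\<^bsub>R\<^esub> x = \<zero>\<^bsub>R\<^esub>"
      by (simp_all add: presented_algebra_simps Q.l_neg)
    then show "\<exists>y\<in>carrier R. y \<oplus>\<^bsub>R\<^esub> x = \<zero>\<^bsub>R\<^esub>" ..
  qed (simp_all add: presented_algebra_simps Q.a_assoc Q.a_comm Q.a_lcomm)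
  show "Group.monoid R"
    by (rule monoidI) (auto simp: presented_algebra_simps Q.m_assoc)
qed (auto simp: presented_algebra_simps Q.l_distr Q.r_distr)

lemma proj_hom: "ring_hom_ring F R proj"
proof (rule ring_hom_ringI2[OF F.ring_axioms ring_presented_algebra])
  show "proj \<in> ring_hom F R"
    using J.rcos_ring_hom by (simp add: ring_hom_def presented_algebra_simps)
qed

sublocale proj: ring_hom_ring F R proj
  by (rule proj_hom)

lemma proj_smult: "p \<in> carrier F \<Longrightarrow> c \<odot>\<^bsub>R\<^esub> proj p = proj (scal c * p)"
  using proj.hom_mult[of "scal c" p]
  by (simp add: presented_algebra_simps(6) free_algebra_closed)

lemma proj_mult: "p \<in> carrier F \<Longrightarrow> q \<in> carrier F \<Longrightarrow> proj p \<otimes>\<^bsub>R\<^esub> proj q = proj (p * q)"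
  using proj.hom_mult[of p q] by simp

lemma proj_one: "\<one>\<^bsub>R\<^esub> = proj 1"
  using proj.hom_one by simp

lemma proj_diff:
  assumes "p \<in> carrier F" "q \<in> carrier F"
  shows "proj p \<ominus>\<^bsub>R\<^esub> proj q = proj (p - q)"
proof -
  have "proj (p \<ominus>\<^bsub>F\<^esub> q) = proj p \<ominus>\<^bsub>R\<^esub> proj q"
    unfolding a_minus_def using assms proj.hom_add proj.hom_a_inv F.a_inv_closed by simp
  then show ?thesis
    using assms by (simp add: free_algebra_minus)
qed

lemma proj_finsum:
  assumes "\<And>i. i \<in> A \<Longrightarrow> g i = proj (f i)" "\<And>i. i \<in> A \<Longrightarrow> f i \<in> carrier F"
  shows "(\<Oplus>\<^bsub>R\<^esub>i\<in>A. g i) = proj (\<Sum>i\<in>A. f i)"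
proof -
  have "(\<Oplus>\<^bsub>R\<^esub>i\<in>A. g i) = (\<Oplus>\<^bsub>R\<^esub>i\<in>A. (proj \<circ> f) i)"
    using assms by (intro proj.S.finsum_cong') auto
  also have "\<dots> = proj (finsum F f A)"
    using assms(2) by (intro proj.hom_finsum[symmetric]) auto
  also have "finsum F f A = sum f A"
    using assms(2) by (intro finsum_free_algebra) auto
  finally show ?thesis .
qed

text \<open>Membership of the product is proved along with the equation, since
  \<open>proj_mult\<close> asks for it at every step of the induction.\<close>

lemma proj_oprod:
  assumes "\<And>i. i \<in> set xs \<Longrightarrow> g i = proj (f i)" "\<And>i. i \<in> set xs \<Longrightarrow> f i \<in> carrier F"
  shows "oprod R (map g xs) = proj (prod_list (map f xs)) \<and> prod_list (map f xs) \<in> carrier F"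
  using assms
  by (induction xs) (auto simp: oprod_def proj_one proj_mult free_algebra_closed free_algebra_one_closed)

text \<open>The bridge by which a congruence modulo the ideal becomes an equation in the presented
  algebra.\<close>

lemma proj_eq_iff:
  "p \<in> carrier F \<Longrightarrow> q \<in> carrier F \<Longrightarrow> proj p = proj q \<longleftrightarrow> p - q \<in> J"
  using F.quotient_eq_iff_same_a_r_cos[OF J.ideal_axioms] by (simp add: free_algebra_minus)

end


section \<open>The quantum coordinate ring\<close>

lemma presentation_qcoord: "presentation (index_pairs N) (qcoord_relations r s N)"
  unfolding presentation_def qcoord_relations_def Let_def
  by (auto simp: index_pairs_def intro!: free_algebra_closed)

lemma quantum_matrix_qcoord:
  assumes "s \<noteq> 0"
  shows "quantum_matrix (carrier (free_algebra (index_pairs N)))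
    (genideal (free_algebra (index_pairs N)) (qcoord_relations r s N))
    scal (\<lambda>i j. var (i, j)) N r (inverse s)"
proof -
  interpret presentation "index_pairs N" "qcoord_relations r s N"
    by (rule presentation_qcoord)
  have rel: "p \<in> J" if "p \<in> qcoord_relations r s N" for p
    using that F.genideal_self[OF relations_closed] by blast
  show ?thesis
  proof unfold_locales
    show "p + q \<in> J" if "p \<in> J" "q \<in> J" for p q
      using J.a_closed[OF that] by simp
    show "q * p \<in> J" "p * q \<in> J" if "p \<in> J" "q \<in> carrier F" for p q
      using J.I_l_closed[OF that] J.I_r_closed[OF that] by simp_all
    show "0 \<in> J"
      using J.zero_closed by simp
    show "var (i, j) \<in> carrier F" if "i \<in> {1..N}" "j \<in> {1..N}" for i j
      using that by (intro free_algebra_closed) (simp add: index_pairs_def)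
    show "scal z * p = p * scal z" for z and p :: "(nat \<times> nat) free_alg"
      by (rule scal_commute)
  next
    fix i j k assume "i \<in> {1..N}" "j \<in> {1..N}" "k \<in> {1..N}" "i < j"
    then show "var (i, k) * var (j, k) - scal (inverse s) * (var (j, k) * var (i, k)) \<in> J"
      by (intro rel) (unfold qcoord_relations_def Let_def, blast)
  next
    fix i j k l assume "i \<in> {1..N}" "j \<in> {1..N}" "k \<in> {1..N}" "l \<in> {1..N}" "i < j" "k < l"
    then show "scal r * (var (i, l) * var (j, k)) - scal (inverse s) * (var (j, k) * var (i, l)) \<in> J"
      by (intro rel) (unfold qcoord_relations_def Let_def, blast)
  next
    fix i j k l assume "i \<in> {1..N}" "j \<in> {1..N}" "k \<in> {1..N}" "l \<in> {1..N}" "i < j" "k < l"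
    then show "var (i, k) * var (j, l) - var (j, l) * var (i, k)
        - scal (r - inverse (inverse s)) * (var (i, l) * var (j, k)) \<in> J"
      \<comment> \<open>The locale knows \<open>s\<close> only as \<open>inverse v\<close>, here
        with \<open>v = inverse s\<close>.\<close>
      unfolding inverse_inverse_eq
      by (intro rel) (unfold qcoord_relations_def Let_def, blast)
  qed (use assms in \<open>simp_all add: free_algebra_closed scal_add scal_mult scal_1\<close>)
qed

section \<open>Nonvanishing of the q-factorial, and row minors of size two\<close>

lemma qfact_nonzero:
  assumes "\<not> root_of_unity u"
  shows "qfact u n \<noteq> 0"
proof -
  have "qint u k \<noteq> 0" if "k \<in> {1..n}" for k
  proof
    assume "qint u k = 0"
    \<comment> \<open>The geometric sum: \<open>1 - u ^ k\<close> is \<open>1 - u\<close> times the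
      q-integer.\<close>
    then have "u ^ k = 1"
      using one_diff_power_eq[of u k] by (simp add: qint_def)
    with assms that show False
      by (auto simp: root_of_unity_def)
  qed
  then show ?thesis
    by (simp add: qfact_def)
qed

text \<open>With \<open>m = 4\<close> this shows that the base \<open>v\<^sup>4\<close> of the
  q-factorial is not a root of unity for generic parameters.\<close>

lemma root_of_unity_inverse_power:
  assumes "root_of_unity (inverse s ^ m)" "m \<ge> 1"
  shows "root_of_unity s"
proof -
  from assms(1) obtain k where k: "k \<ge> 1" "(inverse s ^ m) ^ k = 1"
    by (auto simp: root_of_unity_def)
  then have "s ^ (m * k) = 1"
    by (simp add: power_inverse flip: power_mult)
  with k(1) assms(2) show ?thesis
    unfolding root_of_unity_def by (intro exI[of _ "m * k"]) auto
qed

lemma (in presentation) rdet_minor_2: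
  assumes "\<And>k l. k \<in> {i, j} \<Longrightarrow> l \<in> {c, d} \<Longrightarrow> A k l = proj (f k l) \<and> f k l \<in> carrier F"
  shows "rdet_minor R z A [i, j] [c, d] = proj (f i c * f j d - scal z * (f i d * f j c))"
proof -
  define g where "g \<sigma> k = f ([i, j] ! k) ([c, d] ! \<sigma> k)" for \<sigma> :: "nat \<Rightarrow> nat" and k
  let ?P = "{\<sigma>. \<sigma> permutes {..<length [i, j]}}"
  have g: "A ([i, j] ! k) ([c, d] ! \<sigma> k) = proj (g \<sigma> k) \<and> g \<sigma> k \<in> carrier F"
    if "\<sigma> \<in> ?P" "k \<in> set [0..<length [i, j]]" for \<sigma> k
  proof -
    have "\<sigma> k < 2" "k < 2"
      using that permutes_in_image[of \<sigma> "{..<length [i, j]}" k] by auto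
    then have "[i, j] ! k \<in> {i, j}" "[c, d] ! \<sigma> k \<in> {c, d}"
      by (auto simp: less_2_cases_iff)
    then show ?thesis
      unfolding g_def by (rule assms)
  qed
  have "rdet_minor R z A [i, j] [c, d] = proj (\<Sum>\<sigma>\<in>?P.
      scal ((- z) ^ inversions {..<length [i, j]} \<sigma>) * prod_list (map (g \<sigma>) [0..<length [i, j]]))"
    unfolding rdet_minor_def
  proof (rule proj_finsum)
    fix \<sigma> assume \<sigma>: "\<sigma> \<in> ?P"
    from proj_oprod[of "[0..<length [i, j]]" "\<lambda>k. A ([i, j] ! k) ([c, d] ! \<sigma> k)" "g \<sigma>"] g[OF \<sigma>]
    have *: "oprod R (map (\<lambda>k. A ([i, j] ! k) ([c, d] ! \<sigma> k)) [0..<length [i, j]])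
        = proj (prod_list (map (g \<sigma>) [0..<length [i, j]]))"
      "prod_list (map (g \<sigma>) [0..<length [i, j]]) \<in> carrier F"
      by blast+
    show "(- z) ^ inversions {..<length [i, j]} \<sigma> \<odot>\<^bsub>R\<^esub>
        oprod R (map (\<lambda>k. A ([i, j] ! k) ([c, d] ! \<sigma> k)) [0..<length [i, j]])
      = proj (scal ((- z) ^ inversions {..<length [i, j]} \<sigma>) * prod_list (map (g \<sigma>) [0..<length [i, j]]))"
      unfolding *(1) by (rule proj_smult[OF *(2)])
    show "scal ((- z) ^ inversions {..<length [i, j]} \<sigma>) * prod_list (map (g \<sigma>) [0..<length [i, j]]) \<in> carrier F"
      by (intro free_algebra_closed *(2))
  qed
  also have "(\<Sum>\<sigma>\<in>?P. scal ((- z) ^ inversions {..<length [i, j]} \<sigma>) *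
      prod_list (map (g \<sigma>) [0..<length [i, j]])) = f i c * f j d - scal z * (f i d * f j c)"
  proof -
    \<comment> \<open>List positions start at 0, so the two permutations act on 0 and 1: the
      identity without inversions, and the transposition with one, whence the weight
      \<open>-z\<close>.\<close>
    have dom: "{..<length [i, j]} = {0, 1}" by auto
    have perms: "?P = {id, Transposition.transpose 0 1}"
      unfolding dom by (auto simp: permutes_doubleton_iff)
    have "{(i, j). i \<in> {0, 1} \<and> j \<in> {0, 1} \<and> i < j \<and> id j < id i} = ({} :: (nat \<times> nat) set)"
      by auto
    then have inv_id: "inversions {0, 1} id = 0"
      by (simp only: inversions_def card.empty)
    have "{(i, j). i \<in> {0, 1} \<and> j \<in> {0, 1} \<and> i < j \<and>
        Transposition.transpose 0 1 j < Transposition.transpose 0 (1::nat) i} = {(0::nat, 1)}"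
      by (auto simp: Transposition.transpose_def)
    then have inv_tr: "inversions {0, 1} (Transposition.transpose 0 1) = 1"
      by (simp only: inversions_def card.empty card.insert) simp
    have ne: "id \<noteq> Transposition.transpose 0 (1::nat)"
      by (auto simp: fun_eq_iff Transposition.transpose_def)
    have "[0..<length [i, j]] = [0, 1]" by (simp add: upt_conv_Cons)
    then show ?thesis
      unfolding perms unfolding dom
      using ne by (simp add: inv_id[unfolded One_nat_def] inv_tr[unfolded One_nat_def] scal_1 scal_minus g_def)
  qed
  finally show ?thesis .
qed

theorem theorem3p2:
  fixes n :: nat and r s :: complex
  assumes "n \<ge> 1" and "generic r s"
  shows "let R = qcoord_ring r s (2 * n);
             A = qcoord_gen r s (2 * n);
             B = mat_mult R (2 * n) (mat_mult R (2 * n) A (mat_scalars R (JJ r))) (mat_transpose A)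
         in Pf R (inverse s) n B = cdet R (inverse s) (2 * n) A \<and>
            (\<forall>i\<in>{1..2 * n}. \<forall>j\<in>{1..2 * n}. i < j \<longrightarrow>
               B i j = (\<Oplus>\<^bsub>R\<^esub>m\<in>{1..n}. rdet_minor R r A [i, j] [2 * m - 1, 2 * m]) \<and>
               B i j = (\<Oplus>\<^bsub>R\<^esub>m\<in>{1..n}. (A i (2 * m - 1) \<otimes>\<^bsub>R\<^esub> A j (2 * m))
                          \<ominus>\<^bsub>R\<^esub> (r \<odot>\<^bsub>R\<^esub> (A i (2 * m) \<otimes>\<^bsub>R\<^esub> A j (2 * m - 1)))))"
proof -
  define N where "N = 2 * n"
  define v where "v = inverse s"
  have s: "s \<noteq> 0" "\<not> root_of_unity s"
    using assms(2) by (auto simp: generic_def)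
  interpret presentation "index_pairs N" "qcoord_relations r s N"
    by (rule presentation_qcoord)
  interpret M: quantum_matrix "carrier F" J scal "\<lambda>i j. var (i, j)" N r v
    unfolding v_def by (rule quantum_matrix_qcoord[OF s(1)])
  define A where "A = qcoord_gen r s N"
  define B where "B = mat_mult R N (mat_mult R N A (mat_scalars R (JJ r))) (mat_transpose A)"
  have R: "qcoord_ring r s N = R"
    by (simp add: qcoord_ring_def)
  have A: "A i j = proj (var (i, j))" for i j
    by (simp add: A_def qcoord_gen_def presented_gen_def)

  \<comment> \<open>The formal matrix product already equals \<open>pf_entry\<close> in the free
    algebra, before any relation is imposed.\<close>
  have B: "B i j = proj (M.pf_entry n i j)" if ij: "i \<in> {1..N}" "j \<in> {1..N}" for i j
  proof -
    have scalars: "mat_scalars R C l k = proj (scal (C l k))" for C l k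
      unfolding mat_scalars_def proj_one
      by (subst proj_smult) (simp_all add: free_algebra_one_closed)
    have inner: "mat_mult R N A (mat_scalars R C) i k = proj (\<Sum>l\<in>{1..N}. var (i, l) * scal (C l k))" for C k
      unfolding mat_mult_def
      by (intro proj_finsum)
         (simp_all add: A scalars proj_mult free_algebra_closed M.C_gen[OF ij(1)])
    have "B i j = proj (\<Sum>k\<in>{1..N}. (\<Sum>l\<in>{1..N}. var (i, l) * scal (JJ r l k)) * var (j, k))"
      unfolding B_def mat_mult_def[of R N "mat_mult R N A (mat_scalars R (JJ r))"] mat_transpose_def inner
    proof (rule proj_finsum)
      fix k assume k: "k \<in> {1..N}"
      have *: "(\<Sum>l\<in>{1..N}. var (i, l) * scal (JJ r l k)) \<in> carrier F" "var (j, k) \<in> carrier F"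
        using ij k by (auto intro!: M.C_sum M.C_mult M.C_gen M.C_sc)
      show "proj (\<Sum>l\<in>{1..N}. var (i, l) * scal (JJ r l k)) \<otimes>\<^bsub>R\<^esub> A j k
          = proj ((\<Sum>l\<in>{1..N}. var (i, l) * scal (JJ r l k)) * var (j, k))"
        unfolding A by (rule proj_mult[OF *])
      show "(\<Sum>l\<in>{1..N}. var (i, l) * scal (JJ r l k)) * var (j, k) \<in> carrier F"
        by (rule M.C_mult[OF *])
    qed
    then show ?thesis
      by (simp only: M.sum_JJ[OF N_def])
  qed

  have cdet: "cdet R v N A = proj (M.qdet [1..<N + 1])"
    unfolding cdet_def M.qdet_upt
  proof (rule proj_finsum)
    fix \<sigma> assume \<sigma>: "\<sigma> \<in> {\<sigma>. \<sigma> permutes {1..N}}"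
    have "var (\<sigma> k, k) \<in> carrier F" if "k \<in> set [1..<N + 1]" for k
      using that \<sigma> permutes_in_image[of \<sigma> "{1..N}" k] by (intro M.C_gen) auto
    then have *: "oprod R (map (\<lambda>k. A (\<sigma> k) k) [1..<N + 1]) = proj (prod_list (map (\<lambda>k. var (\<sigma> k, k)) [1..<N + 1]))"
        "prod_list (map (\<lambda>k. var (\<sigma> k, k)) [1..<N + 1]) \<in> carrier F"
      using proj_oprod[of "[1..<N + 1]" "\<lambda>k. A (\<sigma> k) k" "\<lambda>k. var (\<sigma> k, k)"] A by blast+
    show "(- v) ^ inversions {1..N} \<sigma> \<odot>\<^bsub>R\<^esub> oprod R (map (\<lambda>k. A (\<sigma> k) k) [1..<N + 1])
        = proj (scal ((- v) ^ inversions {1..N} \<sigma>) * prod_list (map (\<lambda>k. var (\<sigma> k, k)) [1..<N + 1]))"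
      unfolding *(1) by (rule proj_smult[OF *(2)])
    show "scal ((- v) ^ inversions {1..N} \<sigma>) * prod_list (map (\<lambda>k. var (\<sigma> k, k)) [1..<N + 1]) \<in> carrier F"
      by (intro M.C_mult M.C_sc *(2))
  qed

  let ?q = "qfact (v ^ 4) n"
  let ?term = "\<lambda>\<sigma>. scal ((- v) ^ inversions {1..2 * n} \<sigma>) *
    prod_list (map (\<lambda>i. M.pf_entry n (\<sigma> (2 * i - 1)) (\<sigma> (2 * i))) [1..<n + 1])"
  have Pf: "Pf R v n B = proj (scal (1 / ?q) * (\<Sum>\<sigma>\<in>Pf_perms n. ?term \<sigma>))"
    and sum_C: "(\<Sum>\<sigma>\<in>Pf_perms n. ?term \<sigma>) \<in> carrier F"
  proof -
    have summand: "(- v) ^ inversions {1..2 * n} \<sigma> \<odot>\<^bsub>R\<^esub>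
         oprod R (map (\<lambda>i. B (\<sigma> (2 * i - 1)) (\<sigma> (2 * i))) [1..<n + 1]) = proj (?term \<sigma>) \<and>
       ?term \<sigma> \<in> carrier F" if "\<sigma> \<in> Pf_perms n" for \<sigma>
    proof -
      have \<sigma>: "\<sigma> permutes {1..N}"
        using that by (simp add: Pf_perms_def N_def)
      have mem: "\<sigma> (2 * i - 1) \<in> {1..N}" "\<sigma> (2 * i) \<in> {1..N}" if "i \<in> set [1..<n + 1]" for i
        unfolding permutes_in_image[OF \<sigma>] using that by (auto simp: N_def)
      have *: "oprod R (map (\<lambda>i. B (\<sigma> (2 * i - 1)) (\<sigma> (2 * i))) [1..<n + 1])
          = proj (prod_list (map (\<lambda>i. M.pf_entry n (\<sigma> (2 * i - 1)) (\<sigma> (2 * i))) [1..<n + 1]))"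
        "prod_list (map (\<lambda>i. M.pf_entry n (\<sigma> (2 * i - 1)) (\<sigma> (2 * i))) [1..<n + 1]) \<in> carrier F"
        using proj_oprod[of "[1..<n + 1]" "\<lambda>i. B (\<sigma> (2 * i - 1)) (\<sigma> (2 * i))"
            "\<lambda>i. M.pf_entry n (\<sigma> (2 * i - 1)) (\<sigma> (2 * i))"]
          B[OF mem] M.pf_entry_in_C[OF N_def mem] by blast+
      show ?thesis
        unfolding *(1) using proj_smult[OF *(2)] M.C_mult[OF M.C_sc *(2)] by simp
    qed
    show sum_C: "(\<Sum>\<sigma>\<in>Pf_perms n. ?term \<sigma>) \<in> carrier F"
      using summand by (intro M.C_sum) blast
    have "(\<Oplus>\<^bsub>R\<^esub>\<sigma>\<in>Pf_perms n. (- v) ^ inversions {1..2 * n} \<sigma> \<odot>\<^bsub>R\<^esub>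
         oprod R (map (\<lambda>i. B (\<sigma> (2 * i - 1)) (\<sigma> (2 * i))) [1..<n + 1]))
       = proj (\<Sum>\<sigma>\<in>Pf_perms n. ?term \<sigma>)"
      using summand by (intro proj_finsum) blast+
    then show "Pf R v n B = proj (scal (1 / ?q) * (\<Sum>\<sigma>\<in>Pf_perms n. ?term \<sigma>))"
      unfolding Pf_def using proj_smult[OF sum_C] by simp
  qed

  have qdet_C: "M.qdet [1..<N + 1] \<in> carrier F"
    unfolding M.qdet_def
    by (intro M.C_sum M.C_mult M.C_sc M.word_prod_in_C) (auto simp: words_def)
  have q: "?q \<noteq> 0"
    unfolding v_def using s root_of_unity_inverse_power[of s 4] by (intro qfact_nonzero) auto
  have "M.cg (scal ?q * M.qdet [1..<N + 1]) (\<Sum>\<sigma>\<in>Pf_perms n. ?term \<sigma>)"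
    using M.qfact_qdet_cong[OF N_def] unfolding M.sum_ascending_pairs[OF N_def] .
  \<comment> \<open>Division by the q-factorial, which is an invertible scalar, gives the
    normalization of the Pfaffian.\<close>
  then have "M.cg (scal (1 / ?q) * (scal ?q * M.qdet [1..<N + 1])) (scal (1 / ?q) * (\<Sum>\<sigma>\<in>Pf_perms n. ?term \<sigma>))"
    by (rule M.cg_mult_left[OF _ M.C_sc])
  moreover have "scal (1 / ?q) * (scal ?q * M.qdet [1..<N + 1]) = M.qdet [1..<N + 1]"
    using q by (simp add: scal_1 flip: mult.assoc scal_mult del: upt_Suc)
  ultimately have "M.qdet [1..<N + 1] - scal (1 / ?q) * (\<Sum>\<sigma>\<in>Pf_perms n. ?term \<sigma>) \<in> J"
    by (simp only: M.cg_def)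
  then have "proj (M.qdet [1..<N + 1]) = proj (scal (1 / ?q) * (\<Sum>\<sigma>\<in>Pf_perms n. ?term \<sigma>))"
    by (rule proj_eq_iff[THEN iffD2, OF qdet_C M.C_mult[OF M.C_sc sum_C]])
  then have main: "Pf R v n B = cdet R v N A"
    by (simp only: Pf cdet)

  \<comment> \<open>Both sums have \<open>pf_entry\<close> as representative: the two-by-two minor
    and the expanded difference project from the same term \<open>?t m\<close>.\<close>
  have entries: "B i j = (\<Oplus>\<^bsub>R\<^esub>m\<in>{1..n}. rdet_minor R r A [i, j] [2 * m - 1, 2 * m]) \<and>
      B i j = (\<Oplus>\<^bsub>R\<^esub>m\<in>{1..n}. (A i (2 * m - 1) \<otimes>\<^bsub>R\<^esub> A j (2 * m))
                          \<ominus>\<^bsub>R\<^esub> (r \<odot>\<^bsub>R\<^esub> (A i (2 * m) \<otimes>\<^bsub>R\<^esub> A j (2 * m - 1))))"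
    if ij: "i \<in> {1..N}" "j \<in> {1..N}" for i j
  proof -
    let ?t = "\<lambda>m. var (i, 2 * m - 1) * var (j, 2 * m) - scal r * (var (i, 2 * m) * var (j, 2 * m - 1))"
    have gen: "var (k, l) \<in> carrier F" if "m \<in> {1..n}" "k \<in> {i, j}" "l \<in> {2 * m - 1, 2 * m}" for k l m
      using that ij by (intro M.C_gen) (auto simp: N_def)
    have C: "var (i, 2 * m - 1) * var (j, 2 * m) \<in> carrier F"
      "var (i, 2 * m) * var (j, 2 * m - 1) \<in> carrier F"
      "scal r * (var (i, 2 * m) * var (j, 2 * m - 1)) \<in> carrier F" if "m \<in> {1..n}" for m
      using gen[OF that] by (auto intro!: M.C_mult M.C_sc)
    have t: "?t m \<in> carrier F" if "m \<in> {1..n}" for m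
      using C[OF that] by (intro M.C_diff)
    have rdet: "rdet_minor R r A [i, j] [2 * m - 1, 2 * m] = proj (?t m)" if m: "m \<in> {1..n}" for m
      using gen[OF m] A by (intro rdet_minor_2) blast
    have expanded: "(A i (2 * m - 1) \<otimes>\<^bsub>R\<^esub> A j (2 * m)) \<ominus>\<^bsub>R\<^esub>
        (r \<odot>\<^bsub>R\<^esub> (A i (2 * m) \<otimes>\<^bsub>R\<^esub> A j (2 * m - 1))) = proj (?t m)" if m: "m \<in> {1..n}" for m
    proof -
      have "A i (2 * m - 1) \<otimes>\<^bsub>R\<^esub> A j (2 * m) = proj (var (i, 2 * m - 1) * var (j, 2 * m))"
        "A i (2 * m) \<otimes>\<^bsub>R\<^esub> A j (2 * m - 1) = proj (var (i, 2 * m) * var (j, 2 * m - 1))"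
        unfolding A using gen[OF m] by (auto intro!: proj_mult)
      then show ?thesis
        by (simp only: proj_smult[OF C(2)[OF m]] proj_diff[OF C(1)[OF m] C(3)[OF m]])
    qed
    have "B i j = proj (\<Sum>m\<in>{1..n}. ?t m)"
      unfolding B[OF ij] M.pf_entry_def ..
    then show ?thesis
      using proj_finsum[OF rdet t, of "{1..n}" "\<lambda>m. m"] proj_finsum[OF expanded t, of "{1..n}" "\<lambda>m. m"]
      by simp
  qed
  show ?thesis
    using main entries
    unfolding Let_def N_def[symmetric] v_def[symmetric] R A_def[symmetric] B_def[symmetric]
    by blast
qed

end
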